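(* Let $X,Y$ be computable Banach spaces. Then $\mathsf{IMT}_{X,Y}\le_W\mathsf{C_{\mathbb N}}\equiv_W\mathsf{IMT}_{\ell^2,\ell^2}$.
   Context: A represented space is a pair $(X,\delta_X)$ with $\delta_X:\subseteq\mathbb N^{\mathbb N}\to X$ a partial surjection. For a partial multi-valued map $f:\subseteq X\rightrightarrows Y$ between represented spaces, a realizer of $f$ is a partial function $F:\subseteq\mathbb N^{\mathbb N}\to\mathbb N^{\mathbb N}$ with $\delta_Y(F(p))\in f(\delta_X(p))$ for all $p\in\mathrm{dom}(f\circ\delta_X)$. We write $f\le_W g$ (Weihrauch reducibility) if there are computable partial functions $H,K:\subseteq\mathbb N^{\mathbb N}\to\mathbb N^{\mathbb N}$ such that for every realizer $G$ of $g$ the function $p\mapsto H\langle p,G(K(p))\rangle$ is a realizer of $f$, where $\langle\cdot,\cdot\rangle$ is a standard computable pairing on $\mathbb N^{\mathbb N}$. $\equiv_W$ is the induced equivalence. $\mathcal A_-(\mathbb N)$ is the set of subsets of $\mathbb N$, where $p$ names $A$ iff $\mathbb N\setminus A=\{n:n+1\in\mathrm{range}(p)\}$; $\mathsf{C_{\mathbb N}}:\subseteq\mathcal A_-(\mathbb N)\rightrightarrows\mathbb N$, $A\mapsto A$, on non-empty $A$. A computable Banach space is a (real) Banach space together with a sequence whose linear span is dense, such that the induced metric space (with rational linear combinations as dense set) is a complete computable metric space; points are represented by the Cauchy representation $\delta_X$. $\mathcal C(X,Y)$ is the space of continuous $T:X\to Y$ with the standard function space representation $[\delta_X\to\delta_Y]$.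 $\ell^2$ is the standard computable Hilbert space of square-summable sequences. $\mathsf{IMT}_{X,Y}:\subseteq\mathcal C(X,Y)\to\mathcal C(Y,X)$, $T\mapsto T^{-1}$, defined on the linear bounded bijective $T$. *)

theory Defs
  imports "HOL-Analysis.Analysis" "HOL-Library.Nat_Bijection"
begin

type_synonym baire = "nat \<Rightarrow> nat"

datatype rf = RZero | RSucc | RProj nat | ROracle | RComp rf "rf list" | RPrec rf rf | RMin rf

inductive eval :: "baire \<Rightarrow> rf \<Rightarrow> nat list \<Rightarrow> nat \<Rightarrow> bool" for p where
  ev_zero: "eval p RZero xs 0"
| ev_succ: "eval p RSucc (x # xs) (Suc x)"
| ev_proj: "i < length xs \<Longrightarrow> eval p (RProj i) xs (xs ! i)"
| ev_oracle: "eval p ROracle (x # xs) (p x)"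
| ev_comp: "length ys = length gs \<Longrightarrow> (\<forall>i<length gs. eval p (gs ! i) xs (ys ! i))
             \<Longrightarrow> eval p f ys z \<Longrightarrow> eval p (RComp f gs) xs z"
| ev_prec0: "eval p f xs y \<Longrightarrow> eval p (RPrec f g) (0 # xs) y"
| ev_precS: "eval p (RPrec f g) (n # xs) y \<Longrightarrow> eval p g (n # y # xs) z
             \<Longrightarrow> eval p (RPrec f g) (Suc n # xs) z"
| ev_min: "eval p f (n # xs) 0 \<Longrightarrow> (\<forall>m<n. \<exists>y. eval p f (m # xs) (Suc y))
             \<Longrightarrow> eval p (RMin f) xs n"

definition computable_partial :: "(baire \<Rightarrow> baire option) \<Rightarrow> bool" where
  "computable_partial F \<longleftrightarrow>
     (\<exists>c. \<forall>p q. F p = Some q \<longrightarrow> (\<forall>n. eval p c [n] (q n)))"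

definition bpair :: "baire \<Rightarrow> baire \<Rightarrow> baire" where
  "bpair p q = (\<lambda>n. if even n then p (n div 2) else q (n div 2))"

text \<open>A representation of a set of type 'a is given by its naming relation
  (names p x iff delta p = x).\<close>

definition realizer :: "(baire \<Rightarrow> 'a \<Rightarrow> bool) \<Rightarrow> (baire \<Rightarrow> 'b \<Rightarrow> bool)
    \<Rightarrow> ('a \<Rightarrow> 'b set) \<Rightarrow> (baire \<Rightarrow> baire option) \<Rightarrow> bool" where
  "realizer dX dY f F \<longleftrightarrow>
     (\<forall>p x. dX p x \<and> f x \<noteq> {} \<longrightarrow> (\<exists>q y. F p = Some q \<and> dY q y \<and> y \<in> f x))"

definition weihrauch_le ::
  "(baire \<Rightarrow> 'a \<Rightarrow> bool) \<Rightarrow> (baire \<Rightarrow> 'b \<Rightarrow> bool) \<Rightarrow> ('a \<Rightarrow> 'b set)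
   \<Rightarrow> (baire \<Rightarrow> 'c \<Rightarrow> bool) \<Rightarrow> (baire \<Rightarrow> 'd \<Rightarrow> bool) \<Rightarrow> ('c \<Rightarrow> 'd set) \<Rightarrow> bool" where
  "weihrauch_le dA dB f dC dD g \<longleftrightarrow>
     (\<exists>H K. computable_partial H \<and> computable_partial K \<and>
        (\<forall>G. realizer dC dD g G \<longrightarrow>
           realizer dA dB f (\<lambda>p. case K p of None \<Rightarrow> None
                                   | Some k \<Rightarrow> (case G k of None \<Rightarrow> None
                                                 | Some r \<Rightarrow> H (bpair p r)))))"

definition nat_names :: "baire \<Rightarrow> nat \<Rightarrow> bool" where
  "nat_names p n \<longleftrightarrow> p 0 = n"

definition Aminus_names :: "baire \<Rightarrow> nat set \<Rightarrow> bool" where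
  "Aminus_names p A \<longleftrightarrow> - A = {n. Suc n \<in> range p}"

definition CN :: "nat set \<Rightarrow> nat set" where
  "CN A = A"

definition rat_dec :: "nat \<Rightarrow> real" where
  "rat_dec a = (case prod_decode a of (z, d) \<Rightarrow> of_int (int_decode z) / of_nat (Suc d))"

definition ratcomb :: "(nat \<Rightarrow> 'a::real_vector) \<Rightarrow> nat \<Rightarrow> 'a" where
  "ratcomb e n = (\<Sum>(a, i) \<leftarrow> map prod_decode (list_decode n). rat_dec a *\<^sub>R e i)"

definition computable_banach :: "(nat \<Rightarrow> 'a::banach) \<Rightarrow> bool" where
  "computable_banach e \<longleftrightarrow>
     closure (span (range e)) = UNIV \<and>
     (\<exists>c. \<forall>i j k. \<exists>r. eval (\<lambda>_. 0) c [i, j, k] r \<and>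
              \<bar>dist (ratcomb e i) (ratcomb e j) - rat_dec r\<bar> \<le> (1/2) ^ k)"

definition cauchy_names :: "(nat \<Rightarrow> 'a::real_normed_vector) \<Rightarrow> baire \<Rightarrow> 'a \<Rightarrow> bool" where
  "cauchy_names e p x \<longleftrightarrow> (\<forall>n. dist (ratcomb e (p n)) x \<le> (1/2) ^ n)"

text \<open>Application of a Kleene associate p to q (a standard representation of the
  continuous partial functions on Baire space).\<close>
definition assoc_apply :: "baire \<Rightarrow> baire \<Rightarrow> baire \<Rightarrow> bool" where
  "assoc_apply p q r \<longleftrightarrow>
     (\<forall>n. \<exists>k. p (prod_encode (n, list_encode (map q [0..<k]))) = Suc (r n) \<and>
              (\<forall>j<k. p (prod_encode (n, list_encode (map q [0..<j]))) = 0))"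

definition fun_names :: "(baire \<Rightarrow> 'a::topological_space \<Rightarrow> bool) \<Rightarrow>
    (baire \<Rightarrow> 'b::topological_space \<Rightarrow> bool) \<Rightarrow> baire \<Rightarrow> ('a \<Rightarrow> 'b) \<Rightarrow> bool" where
  "fun_names dX dY p T \<longleftrightarrow> continuous_on UNIV T \<and>
     (\<forall>q x. dX q x \<longrightarrow> (\<exists>r. assoc_apply p q r \<and> dY r (T x)))"

definition IMT :: "('a::real_normed_vector \<Rightarrow> 'b::real_normed_vector) \<Rightarrow> ('b \<Rightarrow> 'a) set" where
  "IMT T = (if bounded_linear T \<and> bij T then {inv T} else {})"

typedef l2 = "{f::nat \<Rightarrow> real. summable (\<lambda>n. (f n)\<^sup>2)}" morphisms l2_seq Abs_l2
  by (rule exI[of _ "\<lambda>_. 0"]) simp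

setup_lifting type_definition_l2

lemma l2_summable_mult:
  fixes f g :: "nat \<Rightarrow> real"
  assumes "summable (\<lambda>n. (f n)\<^sup>2)" "summable (\<lambda>n. (g n)\<^sup>2)"
  shows "summable (\<lambda>n. f n * g n)"
proof -
  have "summable (\<lambda>n. ((f n)\<^sup>2 + (g n)\<^sup>2) / 2)"
    using assms by (intro summable_divide summable_add)
  moreover have le: "norm (f n * g n) \<le> ((f n)\<^sup>2 + (g n)\<^sup>2) / 2" for n
  proof -
    have "0 \<le> (\<bar>f n\<bar> - \<bar>g n\<bar>)\<^sup>2" by simp
    then show ?thesis by (simp add: power2_eq_square abs_mult algebra_simps)
  qed
  ultimately show ?thesis by (rule summable_comparison_test')
qed

lemma l2_summable_add:
  fixes f g :: "nat \<Rightarrow> real"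
  assumes "summable (\<lambda>n. (f n)\<^sup>2)" "summable (\<lambda>n. (g n)\<^sup>2)"
  shows "summable (\<lambda>n. (f n + g n)\<^sup>2)"
proof -
  have "summable (\<lambda>n. (f n)\<^sup>2 + 2 * (f n * g n) + (g n)\<^sup>2)"
    using assms l2_summable_mult[OF assms] by (intro summable_add summable_mult) auto
  then show ?thesis by (simp add: power2_eq_square algebra_simps)
qed

instantiation l2 :: real_vector
begin
lift_definition zero_l2 :: l2 is "\<lambda>_. 0" by simp
lift_definition plus_l2 :: "l2 \<Rightarrow> l2 \<Rightarrow> l2" is "\<lambda>f g n. f n + g n"
  by (rule l2_summable_add)
lift_definition uminus_l2 :: "l2 \<Rightarrow> l2" is "\<lambda>f n. - f n" by simp
lift_definition minus_l2 :: "l2 \<Rightarrow> l2 \<Rightarrow> l2" is "\<lambda>f g n. f n - g n"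
proof -
  fix f g :: "nat \<Rightarrow> real"
  assume "summable (\<lambda>n. (f n)\<^sup>2)" "summable (\<lambda>n. (g n)\<^sup>2)"
  then have "summable (\<lambda>n. (f n + - g n)\<^sup>2)" by (intro l2_summable_add) auto
  then show "summable (\<lambda>n. (f n - g n)\<^sup>2)" by simp
qed
lift_definition scaleR_l2 :: "real \<Rightarrow> l2 \<Rightarrow> l2" is "\<lambda>c f n. c * f n"
  by (simp add: power_mult_distrib summable_mult)
instance
  by standard (transfer; auto simp: algebra_simps)+
end

instantiation l2 :: real_inner
begin
lift_definition inner_l2 :: "l2 \<Rightarrow> l2 \<Rightarrow> real" is "\<lambda>f g. \<Sum>n. f n * g n" .
definition norm_l2 :: "l2 \<Rightarrow> real" where "norm_l2 x = sqrt (inner x x)"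
definition dist_l2 :: "l2 \<Rightarrow> l2 \<Rightarrow> real" where "dist_l2 x y = norm (x - y)"
definition sgn_l2 :: "l2 \<Rightarrow> l2" where "sgn_l2 x = x /\<^sub>R norm x"
definition uniformity_l2 :: "(l2 \<times> l2) filter" where
  "uniformity_l2 = (INF e\<in>{0<..}. principal {(x, y). dist x y < e})"
definition open_l2 :: "l2 set \<Rightarrow> bool" where
  "open_l2 U = (\<forall>x\<in>U. \<forall>\<^sub>F (x', y) in uniformity. x' = x \<longrightarrow> y \<in> U)"
instance
proof
  fix x y z :: l2 and r :: real
  show "inner x y = inner y x" by transfer (simp add: mult.commute)
  show "inner (x + y) z = inner x z + inner y z"
    by transfer (simp add: distrib_right suminf_add l2_summable_mult)
  show "inner (r *\<^sub>R x) y = r * inner x y"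
    by transfer (simp add: mult.assoc suminf_mult l2_summable_mult)
  show "0 \<le> inner x x"
  proof transfer
    fix f :: "nat \<Rightarrow> real" assume "summable (\<lambda>n. (f n)\<^sup>2)"
    then have s: "summable (\<lambda>n. f n * f n)" by (simp add: power2_eq_square)
    show "0 \<le> (\<Sum>n. f n * f n)" by (rule suminf_nonneg[OF s]) simp
  qed
  show "inner x x = 0 \<longleftrightarrow> x = 0"
  proof transfer
    fix f :: "nat \<Rightarrow> real" assume "summable (\<lambda>n. (f n)\<^sup>2)"
    then have s: "summable (\<lambda>n. f n * f n)" by (simp add: power2_eq_square)
    show "(\<Sum>n. f n * f n) = 0 \<longleftrightarrow> f = (\<lambda>_. 0)"
      using suminf_eq_zero_iff[OF s] by (auto simp: fun_eq_iff)
  qed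
  show "norm x = sqrt (inner x x)" by (simp add: norm_l2_def)
qed (simp_all add: dist_l2_def sgn_l2_def uniformity_l2_def open_l2_def)
end

lift_definition l2_unit :: "nat \<Rightarrow> l2" is "\<lambda>k n. if n = k then 1 else 0"
proof -
  fix k :: nat
  have "(\<lambda>n. (if n = k then (1::real) else 0)\<^sup>2) = (\<lambda>n. if n = k then 1 else 0)"
    by auto
  then show "summable (\<lambda>n. (if n = k then (1::real) else 0)\<^sup>2)"
    using summable_single[of k "\<lambda>_. 1::real"] by simp
qed

end

theory Submission
  imports Defs
begin

text \<open>
  Upper bound: by the bounded inverse theorem some \<open>M\<close> satisfies \<open>\<parallel>x\<parallel> \<le> M \<parallel>T x\<parallel>\<close> for all \<open>x\<close>, and a
  violation of this inequality is witnessed by a rational combination at finite precision, so the set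
  of valid \<open>M\<close> is co-enumerable from a name of \<open>T\<close>. Once \<open>C\<^sub>\<nat>\<close> has supplied \<open>M\<close>, the value
  \<open>T\<^sup>-\<^sup>1 y\<close> is computed by searching for a rational combination \<open>x\<close> with \<open>T x\<close> close to \<open>y\<close>.

  Lower bound: from an enumeration of the complement of \<open>A\<close> guess an element of \<open>A\<close>, moving to the next
  number each time the current guess is refuted. The guess changes finitely often, so the diagonal
  operator on \<open>\<ell>\<^sup>2\<close> that multiplies the \<open>n\<close>-th coordinate by \<open>2\<^sup>-\<^sup>n\<close> exactly when there is a change at
  stage \<open>n\<close> is bijective. Its inverse maps \<open>(2\<^sup>-\<^sup>n)\<^sub>n\<close> to a sequence that equals \<open>1\<close> at every change;
  a finitely supported approximation of it within \<open>1/2\<close> therefore bounds all stages of change.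
\<close>

section \<open>Total computable functions relative to an oracle\<close>

text \<open>The arguments are passed as an environment \<open>e\<close>, where \<open>e i\<close> is the \<open>i\<close>-th argument. Extending an
  argument list at the front thus only shifts \<open>e\<close>, and computability goals can be solved by pattern
  unification alone.\<close>

definition tot :: "nat \<Rightarrow> (baire \<Rightarrow> (nat \<Rightarrow> nat) \<Rightarrow> nat) \<Rightarrow> bool" where
  "tot n f \<longleftrightarrow> (\<exists>c. \<forall>p xs. length xs = n \<longrightarrow> eval p c xs (f p (\<lambda>i. xs ! i)))"

definition dec :: "nat \<Rightarrow> (baire \<Rightarrow> (nat \<Rightarrow> nat) \<Rightarrow> bool) \<Rightarrow> bool" where
  "dec n P \<longleftrightarrow> tot n (\<lambda>p e. of_bool (P p e))"

named_theorems tot_intros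

lemma tot_proj [tot_intros]: "i < n \<Longrightarrow> tot n (\<lambda>p e. e i)"
  unfolding tot_def by (rule exI[of _ "RProj i"]) (auto intro: ev_proj)

lemma tot_comp:
  assumes "tot m h" "length fs = m" "\<forall>f\<in>set fs. tot n f"
  shows "tot n (\<lambda>p e. h p (\<lambda>i. map (\<lambda>f. f p e) fs ! i))"
proof -
  obtain c where c: "\<And>p xs. length xs = m \<Longrightarrow> eval p c xs (h p (\<lambda>i. xs ! i))"
    using assms(1) by (auto simp: tot_def)
  obtain d where d: "\<And>f p xs. f \<in> set fs \<Longrightarrow> length xs = n \<Longrightarrow> eval p (d f) xs (f p (\<lambda>i. xs ! i))"
    using assms(3) unfolding tot_def by metis
  have "eval p (RComp c (map d fs)) xs (h p (\<lambda>i. map (\<lambda>f. f p (\<lambda>i. xs ! i)) fs ! i))"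
    if "length xs = n" for p xs
    by (rule ev_comp[where ys = "map (\<lambda>f. f p (\<lambda>i. xs ! i)) fs"])
       (use c d that assms(2) in auto)
  then show ?thesis unfolding tot_def by blast
qed

lemma tot_comp1:
  assumes "tot 1 (\<lambda>p e. h p (e 0))" "tot n f"
  shows "tot n (\<lambda>p e. h p (f p e))"
  using tot_comp[OF assms(1), of "[f]" n] assms by simp

lemma tot_comp2:
  assumes "tot 2 (\<lambda>p e. h p (e 0) (e 1))" "tot n f" "tot n g"
  shows "tot n (\<lambda>p e. h p (f p e) (g p e))"
  using tot_comp[OF assms(1), of "[f, g]" n] assms by simp

lemma tot_comp3:
  assumes "tot 3 (\<lambda>p e. h p (e 0) (e 1) (e 2))" "tot n f" "tot n g" "tot n k"
  shows "tot n (\<lambda>p e. h p (f p e) (g p e) (k p e))"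
  using tot_comp[OF assms(1), of "[f, g, k]" n] assms by simp

lemma tot_Suc [tot_intros]:
  assumes "tot n f" shows "tot n (\<lambda>p e. Suc (f p e))"
proof (rule tot_comp1[OF _ assms])
  show "tot 1 (\<lambda>p e. Suc (e 0))"
    unfolding tot_def by (rule exI[of _ RSucc]) (auto simp: length_Suc_conv intro: ev_succ)
qed

lemma tot_oracle [tot_intros]:
  assumes "tot n f" shows "tot n (\<lambda>p e. p (f p e))"
proof (rule tot_comp1[OF _ assms])
  show "tot 1 (\<lambda>p e. p (e 0))"
    unfolding tot_def by (rule exI[of _ ROracle]) (auto simp: length_Suc_conv intro: ev_oracle)
qed

lemma tot_const [tot_intros]: "tot n (\<lambda>p e. k)"
proof (induction k)
  case 0
  show ?case unfolding tot_def by (rule exI[of _ RZero]) (auto intro: ev_zero)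
qed (rule tot_Suc)

lemma tot_rec [tot_intros]:
  assumes "tot n t" "tot n b" "tot (Suc (Suc n)) (\<lambda>p e. s p (\<lambda>i. e (Suc (Suc i))) (e 0) (e 1))"
  shows "tot n (\<lambda>p e. rec_nat (b p e) (s p e) (t p e))"
proof -
  obtain ct cb cs where
    ct: "\<And>p xs. length xs = n \<Longrightarrow> eval p ct xs (t p (\<lambda>i. xs ! i))" and
    cb: "\<And>p xs. length xs = n \<Longrightarrow> eval p cb xs (b p (\<lambda>i. xs ! i))" and
    cs: "\<And>p xs. length xs = Suc (Suc n) \<Longrightarrow>
            eval p cs xs (s p (\<lambda>i. xs ! Suc (Suc i)) (xs ! 0) (xs ! 1))"
    using assms unfolding tot_def by metis
  have rec: "eval p (RPrec cb cs) (m # xs) (rec_nat (b p (\<lambda>i. xs ! i)) (s p (\<lambda>i. xs ! i)) m)"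
    if "length xs = n" for p xs m
  proof (induction m)
    case 0
    show ?case using cb[OF that] by (auto intro: ev_prec0)
  next
    case (Suc m)
    show ?case using ev_precS[OF Suc cs] that by simp
  qed
  have "eval p (RComp (RPrec cb cs) (ct # map RProj [0..<n])) xs
          (rec_nat (b p (\<lambda>i. xs ! i)) (s p (\<lambda>i. xs ! i)) (t p (\<lambda>i. xs ! i)))"
    if "length xs = n" for p xs
  proof (rule ev_comp)
    show "eval p (RPrec cb cs) (t p (\<lambda>i. xs ! i) # xs)
       (rec_nat (b p (\<lambda>i. xs ! i)) (s p (\<lambda>i. xs ! i)) (t p (\<lambda>i. xs ! i)))"
      by (rule rec[OF that])
    show "\<forall>i<length (ct # map RProj [0..<n]).
       eval p ((ct # map RProj [0..<n]) ! i) xs ((t p (\<lambda>i. xs ! i) # xs) ! i)"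
      using ct[OF that] that by (auto simp: nth_Cons' intro!: ev_proj)
  qed (use that in simp)
  then show ?thesis unfolding tot_def by blast
qed

section \<open>Arithmetic and decidable predicates\<close>

lemma tot_add [tot_intros]:
  assumes "tot n f" "tot n g" shows "tot n (\<lambda>p e. f p e + g p e)"
proof -
  have eq: "x + y = rec_nat y (\<lambda>_ r. Suc r) x" for x y :: nat by (induction x) auto
  show ?thesis by (rule tot_comp2[OF _ assms]) (unfold eq, (rule tot_intros | simp; fail)+)
qed

lemma tot_diff [tot_intros]:
  assumes "tot n f" "tot n g" shows "tot n (\<lambda>p e. f p e - g p e)"
proof -
  have pred: "x - 1 = rec_nat 0 (\<lambda>i _. i) x" for x :: nat by (cases x) auto
  have eq: "x - y = rec_nat x (\<lambda>_. rec_nat 0 (\<lambda>i _. i)) y" for x y :: nat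
    by (induction y) (auto simp flip: pred)
  show ?thesis by (rule tot_comp2[OF _ assms]) (unfold eq, (rule tot_intros | simp; fail)+)
qed

lemma tot_mult [tot_intros]:
  assumes "tot n f" "tot n g" shows "tot n (\<lambda>p e. f p e * g p e)"
proof -
  have eq: "x * y = rec_nat 0 (\<lambda>_ r. y + r) x" for x y :: nat by (induction x) auto
  show ?thesis by (rule tot_comp2[OF _ assms]) (unfold eq, (rule tot_intros | simp; fail)+)
qed

lemma tot_power [tot_intros]:
  assumes "tot n f" "tot n g" shows "tot n (\<lambda>p e. f p e ^ g p e)"
proof -
  have eq: "x ^ y = rec_nat 1 (\<lambda>_ r. x * r) y" for x y :: nat by (induction y) auto
  show ?thesis by (rule tot_comp2[OF _ assms]) (unfold eq, (rule tot_intros | simp; fail)+)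
qed

lemma tot_sum [tot_intros]:
  assumes "tot n t" "tot (Suc n) (\<lambda>p e. f p (\<lambda>i. e (Suc i)) (e 0))"
  shows "tot n (\<lambda>p e. \<Sum>i<t p e. f p e i)"
proof -
  have eq: "(\<Sum>i<k. g i) = rec_nat 0 (\<lambda>i r. r + g i) k" for k and g :: "nat \<Rightarrow> nat"
    by (induction k) auto
  \<comment> \<open>The recursion step also carries the partial sum, which \<open>f\<close> must not
    see. As \<open>f\<close> may inspect the whole environment, the remaining arguments are rebuilt
    as the list \<open>ys\<close>, whose indexing equals the shifted environment as a
    function.\<close>
  have 2: "tot (Suc (Suc n)) (\<lambda>p e. f p (\<lambda>i. e (Suc (Suc i))) (e 0))"
  proof -
    have "tot (Suc (Suc n)) (\<lambda>p e. f p (\<lambda>i. map (\<lambda>f. f p e) ((\<lambda>p e. e 0) # map (\<lambda>j p e. e (Suc (Suc j))) [0..<n]) ! Suc i)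
       (map (\<lambda>f. f p e) ((\<lambda>p e. e 0) # map (\<lambda>j p e. e (Suc (Suc j))) [0..<n]) ! 0))"
      by (rule tot_comp[OF assms(2)]) (auto intro!: tot_proj)
    then have "tot (Suc (Suc n)) (\<lambda>p e. f p (\<lambda>i. map (\<lambda>j. e (Suc (Suc j))) [0..<n] ! i) (e 0))"
      by (simp add: comp_def)
    then obtain c where c: "\<And>p xs. length xs = Suc (Suc n) \<Longrightarrow>
          eval p c xs (f p (\<lambda>i. map (\<lambda>j. xs ! Suc (Suc j)) [0..<n] ! i) (xs ! 0))"
      unfolding tot_def by blast
    have "eval p c xs (f p (\<lambda>i. xs ! Suc (Suc i)) (xs ! 0))" if l: "length xs = Suc (Suc n)" for p xs
    proof -
      obtain a b ys where xs: "xs = a # b # ys" "length ys = n"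
        using l by (auto simp: length_Suc_conv)
      have "map (\<lambda>j. xs ! Suc (Suc j)) [0..<n] = ys"
        using xs map_nth[of ys] by simp
      then show ?thesis using c[OF l, of p] xs by simp
    qed
    then show ?thesis unfolding tot_def by blast
  qed
  show ?thesis unfolding eq by (rule tot_intros assms 2 | simp; fail)+
qed

lemma tot_of_bool [tot_intros]: "dec n P \<Longrightarrow> tot n (\<lambda>p e. of_bool (P p e))"
  by (simp add: dec_def)

lemma dec_eq0: assumes "tot n f" shows "dec n (\<lambda>p e. f p e = 0)"
proof -
  have eq: "of_bool (x = 0) = 1 - x" for x :: nat by (cases x) auto
  show ?thesis unfolding dec_def eq by (rule tot_intros assms)+
qed

lemma dec_le [tot_intros]:
  assumes "tot n f" "tot n g" shows "dec n (\<lambda>p e. f p e \<le> g p e)"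
proof -
  have eq: "x \<le> y \<longleftrightarrow> x - y = 0" for x y :: nat by auto
  show ?thesis unfolding eq by (intro dec_eq0 tot_intros assms)
qed

lemma dec_not [tot_intros]: assumes "dec n P" shows "dec n (\<lambda>p e. \<not> P p e)"
  using dec_eq0[OF assms[unfolded dec_def]] by (simp add: dec_def)

lemma dec_less [tot_intros]:
  assumes "tot n f" "tot n g" shows "dec n (\<lambda>p e. f p e < g p e)"
  using dec_not[OF dec_le[OF assms(2,1)]] by (simp add: not_le)

lemma dec_conj [tot_intros]:
  assumes "dec n P" "dec n Q" shows "dec n (\<lambda>p e. P p e \<and> Q p e)"
  using tot_mult[OF assms[unfolded dec_def]] by (simp add: dec_def of_bool_conj)

lemma dec_eq [tot_intros]:
  assumes "tot n f" "tot n g" shows "dec n (\<lambda>p e. f p e = g p e)"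
  using dec_conj[OF dec_le[OF assms] dec_le[OF assms(2,1)]] by (simp add: eq_iff)

lemma dec_bex [tot_intros]:
  assumes "tot n t" "dec (Suc n) (\<lambda>p e. P p (\<lambda>i. e (Suc i)) (e 0))"
  shows "dec n (\<lambda>p e. \<exists>i<t p e. P p e i)"
proof -
  have eq: "(\<exists>i<k. Q i) \<longleftrightarrow> \<not> (\<Sum>i<k. of_bool (Q i)) = (0::nat)" for k and Q :: "nat \<Rightarrow> bool"
    by auto
  show ?thesis unfolding eq by (intro tot_intros assms)
qed

lemma tot_if [tot_intros]:
  assumes "dec n P" "tot n f" "tot n g"
  shows "tot n (\<lambda>p e. if P p e then f p e else g p e)"
proof -
  have eq: "(if b then x else y) = of_bool b * x + (1 - of_bool b) * (y::nat)" for b x y by simp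
  show ?thesis unfolding eq by (intro tot_intros assms)
qed

lemma tot_div [tot_intros]:
  assumes "tot n f" "tot n g" shows "tot n (\<lambda>p e. f p e div g p e)"
proof -
  \<comment> \<open>The quotient is the only \<open>q\<close> passing the test, so the sum returns
    it. For \<open>y = 0\<close> no \<open>q\<close> passes, and the empty sum 0 is the value of
    \<open>x div 0\<close>. Square roots and the components of pairs are found in the same
    way.\<close>
  have eq: "x div y = (\<Sum>q<Suc x. if q * y \<le> x \<and> x < Suc q * y then q else 0)" for x y :: nat
  proof -
    have "(q * y \<le> x \<and> x < Suc q * y) = (0 < y \<and> q = x div y)" for q
      using dividend_less_div_times[of y x] div_nat_eqI[of y q x]
      by (cases "y = 0") (auto simp: algebra_simps)
    then show ?thesis by (cases "y = 0") (simp_all add: less_Suc_eq_le del: sum.lessThan_Suc)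
  qed
  show ?thesis by (rule tot_comp2[OF _ assms]) (unfold eq, (rule tot_intros | simp; fail)+)
qed

lemma tot_mod [tot_intros]:
  assumes "tot n f" "tot n g" shows "tot n (\<lambda>p e. f p e mod g p e)"
  unfolding minus_mult_div_eq_mod[symmetric] by (intro tot_intros assms)

lemma tot_sqrt [tot_intros]:
  assumes "tot n f" shows "tot n (\<lambda>p e. nat \<lfloor>sqrt (real (f p e))\<rfloor>)"
proof -
  have eq: "nat \<lfloor>sqrt (real x)\<rfloor> = (\<Sum>q<Suc x. if q * q \<le> x \<and> x < Suc q * Suc q then q else 0)" for x
  proof -
    have iff: "(q * q \<le> x \<and> x < Suc q * Suc q) = (q = nat \<lfloor>sqrt (real x)\<rfloor>)" for q
    proof -
      have "q = nat \<lfloor>sqrt (real x)\<rfloor> \<longleftrightarrow> real q \<le> sqrt (real x) \<and> sqrt (real x) < real (Suc q)"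
        by (smt (verit) floor_unique floor_correct nat_int of_int_of_nat_eq of_nat_Suc of_nat_nat real_sqrt_ge_zero of_nat_0_le_iff zero_le_floor of_int_1 of_int_add)
      also have "real q \<le> sqrt (real x) \<longleftrightarrow> real (q * q) \<le> real x"
        by (metis of_nat_0_le_iff of_nat_mult power2_eq_square real_le_lsqrt real_le_rsqrt real_sqrt_le_iff real_sqrt_pow2 real_sqrt_unique)
      also have "sqrt (real x) < real (Suc q) \<longleftrightarrow> real x < real (Suc q * Suc q)"
        by (metis of_nat_0_le_iff of_nat_mult real_sqrt_abs2 real_sqrt_less_iff abs_of_nat)
      finally show ?thesis by (simp only: of_nat_le_iff of_nat_less_iff)
    qed
    have "nat \<lfloor>sqrt (real x)\<rfloor> \<le> x"
      using iff[of "nat \<lfloor>sqrt (real x)\<rfloor>"] by (meson le_square order_trans)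
    then show ?thesis unfolding iff by (simp add: less_Suc_eq_le)
  qed
  show ?thesis by (rule tot_comp1[OF _ assms]) (unfold eq, (rule tot_intros | simp; fail)+)
qed

section \<open>Codes of pairs and lists\<close>

lemma tot_prod_encode [tot_intros]:
  assumes "tot n f" "tot n g" shows "tot n (\<lambda>p e. prod_encode (f p e, g p e))"
proof -
  show ?thesis unfolding prod_encode_def triangle_def prod.case by (intro tot_intros assms)
qed

lemma tot_fst [tot_intros]:
  assumes "tot n f" shows "tot n (\<lambda>p e. fst (prod_decode (f p e)))"
proof -
  \<comment> \<open>Both components of a pair are at most its code, which bounds the search.\<close>
  have eq: "fst (prod_decode x) = (\<Sum>a<Suc x. \<Sum>b<Suc x. if prod_encode (a, b) = x then a else 0)" for x
  proof -
    obtain a b where x: "x = prod_encode (a, b)" by (metis prod_decode_inverse surj_pair)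
    have *: "(if prod_encode (a', b') = x then a' else 0) = (if b' = b then if a' = a then a else 0 else 0)" for a' b'
      by (auto simp: x)
    show ?thesis unfolding * using le_prod_encode_1[of a b] le_prod_encode_2[of b a]
      by (simp add: x less_Suc_eq_le)
  qed
  show ?thesis by (rule tot_comp1[OF _ assms]) (unfold eq, (rule tot_intros | simp; fail)+)
qed

lemma tot_snd [tot_intros]:
  assumes "tot n f" shows "tot n (\<lambda>p e. snd (prod_decode (f p e)))"
proof -
  have eq: "snd (prod_decode x) = (\<Sum>a<Suc x. \<Sum>b<Suc x. if prod_encode (a, b) = x then b else 0)" for x
  proof -
    obtain a b where x: "x = prod_encode (a, b)" by (metis prod_decode_inverse surj_pair)
    have *: "(if prod_encode (a', b') = x then b' else 0) = (if b' = b then if a' = a then b else 0 else 0)" for a' b'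
      by (auto simp: x)
    show ?thesis unfolding * using le_prod_encode_1[of a b] le_prod_encode_2[of b a]
      by (simp add: x less_Suc_eq_le)
  qed
  show ?thesis by (rule tot_comp1[OF _ assms]) (unfold eq, (rule tot_intros | simp; fail)+)
qed

definition code_drop :: "nat \<Rightarrow> nat \<Rightarrow> nat" where
  "code_drop c j = rec_nat c (\<lambda>_ r. snd (prod_decode (r - 1))) j"

lemma code_drop_encode: "code_drop (list_encode xs) j = list_encode (drop j xs)"
proof (induction j)
  case (Suc j)
  \<comment> \<open>Code 0, the empty list, has to be its own tail: \<open>0 - 1\<close> is 0, and
    its second component is 0 again.\<close>
  have "snd (prod_decode (0::nat)) = 0"
    by (metis le_prod_encode_2 le_zero_eq prod.collapse prod_decode_inverse)
  then show ?case using Suc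
    by (cases "drop j xs") (simp_all add: code_drop_def drop_Suc drop_tl flip: tl_drop)
qed (simp add: code_drop_def)

lemma code_drop_eq_0: "code_drop (list_encode xs) j = 0 \<longleftrightarrow> length xs \<le> j"
  by (cases "drop j xs") (auto simp: code_drop_encode simp flip: drop_eq_Nil)

lemma tot_code_drop [tot_intros]:
  assumes "tot n f" "tot n g" shows "tot n (\<lambda>p e. code_drop (f p e) (g p e))"
  by (rule tot_comp2[OF _ assms]) (unfold code_drop_def, (rule tot_intros | simp; fail)+)

definition code_nth :: "nat \<Rightarrow> nat \<Rightarrow> nat" where
  "code_nth c j = fst (prod_decode (code_drop c j - 1))"

lemma code_nth_encode: "j < length xs \<Longrightarrow> code_nth (list_encode xs) j = xs ! j"
  by (simp add: code_nth_def code_drop_encode flip: Cons_nth_drop_Suc)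

lemma tot_code_nth [tot_intros]:
  assumes "tot n f" "tot n g" shows "tot n (\<lambda>p e. code_nth (f p e) (g p e))"
  unfolding code_nth_def by (intro tot_intros assms)

lemma length_le_list_encode: "length xs \<le> list_encode xs"
proof (induction xs)
  case (Cons x xs)
  then show ?case using le_prod_encode_2[of "list_encode xs" x] by simp
qed simp

lemma mem_less_list_encode: "x \<in> set xs \<Longrightarrow> x < list_encode xs"
proof (induction xs)
  case (Cons y xs)
  then show ?case using le_prod_encode_1[of y "list_encode xs"] le_prod_encode_2[of "list_encode xs" y]
    by (auto simp: less_Suc_eq_le)
qed simp

text \<open>A list is no longer than its code, so \<open>c\<close> recursion steps reach every
  entry; after the last entry \<open>code_drop\<close> is 0 and the accumulator is passed on
  unchanged.\<close>

lemma fold_list_decode: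
  "fold g (list_decode c) b = rec_nat b (\<lambda>j r. if code_drop c j = 0 then r else g (code_nth c j) r) c"
proof -
  obtain xs where c: "c = list_encode xs" by (metis list_decode_inverse)
  have "fold g (take j xs) b = rec_nat b (\<lambda>j r. if code_drop c j = 0 then r else g (code_nth c j) r) j" for j
  proof (induction j)
    case (Suc j)
    show ?case
    proof (cases "j < length xs")
      case True
      then have "list_encode (drop j xs) \<noteq> 0" by (simp flip: Cons_nth_drop_Suc)
      then show ?thesis using True Suc by (simp add: c code_drop_encode code_nth_encode take_Suc_conv_app_nth)
    qed (use Suc in \<open>simp add: c code_drop_encode\<close>)
  qed simp
  from this[of c] show ?thesis using length_le_list_encode[of xs] by (simp add: c)
qed

lemma tot_fold [tot_intros]:
  assumes "tot n c" "tot n b" "tot (Suc (Suc n)) (\<lambda>p e. g p (\<lambda>i. e (Suc (Suc i))) (e 0) (e 1))"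
  shows "tot n (\<lambda>p e. fold (g p e) (list_decode (c p e)) (b p e))"
proof -
  have w: "tot (Suc (Suc n)) (\<lambda>p e. f p (\<lambda>i. e (Suc (Suc i))))" if "tot n f" for f
  proof -
    from that obtain c where c: "\<And>p xs. length xs = n \<Longrightarrow> eval p c xs (f p (\<lambda>i. xs ! i))"
      unfolding tot_def by blast
    have "eval p (RComp c (map (\<lambda>j. RProj (Suc (Suc j))) [0..<n])) xs (f p (\<lambda>i. xs ! Suc (Suc i)))"
      if l: "length xs = Suc (Suc n)" for p xs
    proof -
      obtain a b ys where xs: "xs = a # b # ys" "length ys = n"
        using l by (auto simp: length_Suc_conv)
      have "eval p (RProj (Suc (Suc i))) (a # b # ys) (ys ! i)" if "i < n" for i
        using ev_proj[of "Suc (Suc i)" "a # b # ys" p] that xs by simp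
      then show ?thesis using c[of ys p] xs
        by (auto intro!: ev_comp[where ys=ys])
    qed
    then show ?thesis unfolding tot_def by blast
  qed
  \<comment> \<open>In the recursion \<open>e 0\<close> is a position, whereas \<open>g\<close>
    expects the entry at this position; \<open>?fs\<close> replaces the one by the other and keeps
    the accumulator and the parameters.\<close>
  let ?G = "\<lambda>p e. g p (\<lambda>i. e (Suc (Suc i))) (code_nth (c p (\<lambda>i. e (Suc (Suc i)))) (e 0)) (e 1)"
  have "tot (Suc (Suc n)) ?G"
  proof -
    let ?fs = "(\<lambda>p e. code_nth (c p (\<lambda>i. e (Suc (Suc i)))) (e 0)) # map (\<lambda>j p e. e (Suc j)) [0..<Suc n]"
    have "\<forall>f\<in>set ?fs. tot (Suc (Suc n)) f"
      by (auto intro!: tot_intros w assms)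
    from tot_comp[OF assms(3) _ this]
    have "tot (Suc (Suc n)) (\<lambda>p e. g p (\<lambda>i. map (\<lambda>f. f p e) ?fs ! Suc (Suc i))
        (map (\<lambda>f. f p e) ?fs ! 0) (map (\<lambda>f. f p e) ?fs ! 1))" by simp
    then obtain d where d: "\<And>p xs. length xs = Suc (Suc n) \<Longrightarrow>
      eval p d xs (g p (\<lambda>i. map (\<lambda>f. f p (\<lambda>i. xs ! i)) ?fs ! Suc (Suc i))
        (map (\<lambda>f. f p (\<lambda>i. xs ! i)) ?fs ! 0) (map (\<lambda>f. f p (\<lambda>i. xs ! i)) ?fs ! 1))"
      unfolding tot_def by blast
    have "eval p d xs (?G p (\<lambda>i. xs ! i))" if l: "length xs = Suc (Suc n)" for p xs
    proof -
      have "map (\<lambda>j. xs ! Suc j) [0..<Suc n] = tl xs"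
        by (rule nth_equalityI) (use l in \<open>simp_all add: nth_tl del: upt_Suc\<close>)
      then have "map (\<lambda>f. f p (\<lambda>i. xs ! i)) ?fs = code_nth (c p (\<lambda>i. xs ! Suc (Suc i))) (xs ! 0) # tl xs"
        by (simp add: comp_def del: upt_Suc)
      moreover have "tl xs ! i = xs ! Suc i" for i using l by (cases xs) auto
      ultimately show ?thesis using d[OF l, of p] by simp
    qed
    then show ?thesis unfolding tot_def by blast
  qed
  then show ?thesis unfolding fold_list_decode
    by (intro tot_intros assms w) simp_all
qed

section \<open>Independence of the oracle, and partial computable functions\<close>

primrec oracle_free :: "rf \<Rightarrow> rf" where
  "oracle_free RZero = RZero"
| "oracle_free RSucc = RSucc"
| "oracle_free (RProj i) = RProj i"
| "oracle_free ROracle = RZero"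
| "oracle_free (RComp f gs) = RComp (oracle_free f) (map oracle_free gs)"
| "oracle_free (RPrec f g) = RPrec (oracle_free f) (oracle_free g)"
| "oracle_free (RMin f) = RMin (oracle_free f)"

text \<open>The metric of a computable Banach space is computed with the zero oracle, whereas the
  reductions run with a name as oracle. Replacing oracle queries by the constant 0 lets them call
  the metric program.\<close>

lemma eval_oracle_free:
  assumes "eval (\<lambda>_. 0) c xs y" shows "eval p (oracle_free c) xs y"
  using assms
proof (induction rule: eval.induct)
  case (ev_comp ys gs xs f z)
  then show ?case by (auto intro!: eval.ev_comp[where ys=ys])
next
  case (ev_min f n xs)
  then show ?case by (auto intro!: eval.ev_min)
qed (auto intro: eval.intros)

lemma computable_partial_total:
  assumes "tot 1 (\<lambda>p e. f p (e 0))"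
  shows "computable_partial (\<lambda>p. Some (f p))"
proof -
  obtain c where "\<And>p xs. length xs = 1 \<Longrightarrow> eval p c xs (f p (xs ! 0))"
    using assms unfolding tot_def by blast
  from this[of "[_]"] show ?thesis unfolding computable_partial_def by auto
qed

text \<open>Unbounded search for a realizer with values in the natural numbers: a name of a number
  is read at position 0 only, so a constant output sequence will do.\<close>

lemma computable_partial_search:
  assumes t: "tot 1 (\<lambda>p e. t p (e 0))" and f: "tot 1 (\<lambda>p e. f p (e 0))"
  shows "computable_partial (\<lambda>p. if \<exists>k. t p k \<noteq> 0 then Some (\<lambda>_. f p (LEAST k. t p k \<noteq> 0)) else None)"
proof -
  \<comment> \<open>\<open>RMin\<close> looks for the first zero and requires successors before it,
    so the test is negated. Its second argument is the ignored output position.\<close>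
  have "tot 2 (\<lambda>p e. 1 - t p (e 0))"
    by (intro tot_intros tot_comp1[OF t]) simp
  then obtain c where c: "\<And>p x y. eval p c [x, y] (1 - t p x)"
    unfolding tot_def by (metis length_Cons list.size(3) nth_Cons_0 numeral_2_eq_2)
  obtain d where d: "\<And>p x. eval p d [x] (f p x)"
    using f unfolding tot_def by (metis One_nat_def length_Cons list.size(3) nth_Cons_0)
  have "eval p (RComp d [RMin c]) [n] (f p (LEAST k. t p k \<noteq> 0))" if "\<exists>k. t p k \<noteq> 0" for p n
  proof (rule ev_comp)
    let ?k = "LEAST k. t p k \<noteq> 0"
    have k: "t p ?k \<noteq> 0" using that by (rule LeastI_ex)
    have less: "t p m = 0" if "m < ?k" for m using not_less_Least[OF that] by simp
    have "eval p (RMin c) [n] ?k"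
    proof (rule ev_min)
      show "eval p c [?k, n] 0" using c[of p ?k n] k by simp
      show "\<forall>m<?k. \<exists>y. eval p c [m, n] (Suc y)" using c[of p _ n] less by (metis diff_zero One_nat_def)
    qed
    then show "\<forall>i<length [RMin c]. eval p ([RMin c] ! i) [n] ([?k] ! i)" by simp
  qed (use d in simp_all)
  then show ?thesis unfolding computable_partial_def by (auto split: if_splits)
qed

section \<open>The bounded inverse theorem\<close>

text \<open>By Baire's theorem the closure of the image of some ball contains a ball, so every
  \<open>y\<close> has approximate preimages of norm at most a constant times \<open>norm y\<close>.
  Summing approximate preimages of successive residuals gives the exact one.\<close>

lemma bounded_inverse_theorem:
  fixes T :: "'a::banach \<Rightarrow> 'b::banach"
  assumes T: "bounded_linear T" and bij: "bij T"
  obtains K where "\<And>x. norm x \<le> K * norm (T x)"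
proof -
  interpret T: bounded_linear T by (rule T)
  define C where "C n = closure (T ` ball 0 (real n))" for n
  have "\<exists>n. interior (C n) \<noteq> {}"
  proof (rule ccontr)
    assume *: "\<not> ?thesis"
    have "\<Union>(range C) = UNIV"
    proof -
      have "y \<in> \<Union>(range C)" for y
      proof -
        obtain x where x: "y = T x" using bij by (metis bij_pointE)
        obtain n where "norm x < real n" using reals_Archimedean2 by blast
        then have "y \<in> C n" unfolding C_def using x by (intro closure_subset[THEN subsetD]) auto
        then show ?thesis by blast
      qed
      then show ?thesis by blast
    qed
    moreover have "Met_TC.mtopology interior_of \<Union>(range C) = {}"
      using * by (intro Met_TC.metric_Baire_category_alt) (auto simp: C_def complete_UNIV)
    ultimately show False by simp
  qed
  then obtain n y0 r where r: "r > 0" "ball y0 r \<subseteq> C n"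
    by (metis all_not_in_conv mem_interior)
  have app: "\<exists>x. norm x \<le> (4 * real n / r) * norm y \<and> norm (y - T x) < e" if e: "e > 0" and y: "y \<noteq> 0" for y e
  proof -
    \<comment> \<open>Half of the radius keeps \<open>y0 + c *\<^sub>R y\<close> inside the ball.
      Subtracting approximate preimages of this point and of \<open>y0\<close> removes the centre;
      both have norm below \<open>n\<close>, and \<open>2 * n / c\<close> is
      \<open>4 * n / r * norm y\<close>.\<close>
    define c where "c = r / (2 * norm y)"
    have c: "c > 0" using r y by (simp add: c_def)
    have "y0 + c *\<^sub>R y \<in> ball y0 r" using r y by (simp add: dist_norm c_def)
    then have "y0 + c *\<^sub>R y \<in> C n" "y0 \<in> C n" using r by auto
    moreover have "c * e / 2 > 0" using c e by simp
    moreover have near: "\<exists>x. norm x < real n \<and> norm (T x - z) < d" if "z \<in> C n" "d > 0" for z d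
      using that unfolding C_def closure_approachable by (force simp: dist_norm)
    ultimately obtain x1 x2 where x: "norm x1 < n" "norm x2 < n"
      "norm (T x1 - (y0 + c *\<^sub>R y)) < c * e / 2" "norm (T x2 - y0) < c * e / 2"
      by metis
    define x where "x = (1/c) *\<^sub>R (x1 - x2)"
    have "norm (x1 - x2) \<le> 2 * real n" using norm_triangle_ineq4[of x1 x2] x by linarith
    then have "norm x \<le> (2 * real n) / c" using c by (simp add: x_def divide_right_mono)
    then have "norm x \<le> (4 * real n / r) * norm y" using y r by (simp add: c_def)
    moreover have "norm (c *\<^sub>R (y - T x)) < c * e"
    proof -
      have "c *\<^sub>R (y - T x) = (T x2 - y0) - (T x1 - (y0 + c *\<^sub>R y))"
        using c by (simp add: x_def T.scale T.diff algebra_simps)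
      then show ?thesis using norm_triangle_ineq4[of "T x2 - y0" "T x1 - (y0 + c *\<^sub>R y)"] x by (simp only:)
    qed
    then have "norm (y - T x) < e" using c by simp
    ultimately show ?thesis by blast
  qed
  define K where "K = 4 * real n / r"
  have K: "K \<ge> 0" using r by (simp add: K_def)
  have app': "\<exists>x. norm x \<le> K * norm y \<and> norm (y - T x) \<le> e" if e: "e > 0" for y e
    using app[OF e, of y] e K by (cases "y = 0") (auto intro: exI[of _ 0] less_imp_le simp: K_def)
  define h where "h y e = (SOME x. norm x \<le> K * norm y \<and> norm (y - T x) \<le> e)" for y e
  have h: "norm (h y e) \<le> K * norm y" "norm (y - T (h y e)) \<le> e" if "e > 0" for y e
    using someI_ex[OF app'[OF that, of y]] by (auto simp: h_def)
  have "norm x \<le> (2 * K) * norm (T x)" for x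
  proof (cases "T x = 0")
    case True
    then have "x = 0" using bij by (metis T.zero bij_pointE)
    then show ?thesis using K by simp
  next
    case False
    define y where "y = T x"
    have y: "norm y > 0" using False by (simp add: y_def)
    \<comment> \<open>\<open>R n\<close> is what remains of \<open>y\<close> after \<open>n\<close>
      corrections. Each correction halves the bound on it, so the corrections \<open>u\<close> are
      dominated by a geometric series with sum \<open>2 * K * norm y\<close>.\<close>
    define R where "R = rec_nat y (\<lambda>n z. z - T (h z (norm y / 2 ^ Suc n)))"
    define u where "u n = h (R n) (norm y / 2 ^ Suc n)" for n
    have R0: "R 0 = y" and RS: "R (Suc n) = R n - T (u n)" for n by (simp_all add: R_def u_def)
    have normR: "norm (R n) \<le> norm y / 2 ^ n" for n
    proof (cases n)
      case (Suc m)
      then show ?thesis using h(2)[of "norm y / 2 ^ Suc m" "R m"] y by (simp add: RS u_def)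
    qed (simp add: R0)
    have normu: "norm (u n) \<le> (K * norm y) * (1/2) ^ n" for n
    proof -
      have "norm (u n) \<le> K * norm (R n)" unfolding u_def using y by (intro h) simp
      also have "\<dots> \<le> K * (norm y / 2 ^ n)" using normR K by (intro mult_left_mono)
      finally show ?thesis by (simp add: power_divide)
    qed
    have g: "(\<lambda>n. (K * norm y) * (1/2) ^ n) sums ((K * norm y) * 2)"
      using sums_mult[OF geometric_sums[of "1/2::real"], of "K * norm y"] by simp
    have sn: "summable (\<lambda>n. norm (u n))"
      using normu by (intro summable_comparison_test'[OF sums_summable[OF g]]) simp
    then have su: "summable u" by (rule summable_norm_cancel)
    have "norm (suminf u) \<le> (\<Sum>n. norm (u n))" by (rule summable_norm[OF sn])
    also have "\<dots> \<le> K * norm y * 2"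
      using suminf_le[OF normu sn sums_summable[OF g]] sums_unique[OF g] by simp
    finally have bound: "norm (suminf u) \<le> 2 * K * norm y" by simp
    have "(\<Sum>i<n. T (u i)) = y - R n" for n by (induction n) (simp_all add: R0 RS)
    moreover have "R \<longlonglongrightarrow> 0"
    proof (rule Lim_null_comparison[where g="\<lambda>n. norm y * (1/2) ^ n"])
      show "\<forall>\<^sub>F n in sequentially. norm (R n) \<le> norm y * (1/2) ^ n"
        using normR by (simp add: power_divide)
      show "(\<lambda>n. norm y * (1/2) ^ n) \<longlonglongrightarrow> 0"
        by (intro tendsto_mult_right_zero LIMSEQ_power_zero) simp
    qed
    ultimately have "(\<lambda>n. T (u n)) sums y"
      unfolding sums_def using tendsto_diff[OF tendsto_const, of R 0 sequentially y] by simp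
    moreover have "(\<lambda>n. T (u n)) sums T (suminf u)"
      using T.sums[OF summable_sums[OF su]] .
    ultimately have "T (suminf u) = T x" using sums_unique2 y_def by blast
    then have "suminf u = x" using bij by (metis bij_pointE)
    then show ?thesis using bound y_def by simp
  qed
  then show ?thesis by (rule that)
qed

section \<open>Computing with names of points and operators\<close>

lemma rat_dec_encode: "rat_dec (prod_encode (int_encode z, d)) = of_int z / of_nat (Suc d)"
  by (simp add: rat_dec_def)

lemma ratcomb_0 [simp]: "ratcomb e 0 = 0"
  by (simp add: ratcomb_def)

lemma ratcomb_Suc:
  "ratcomb e (Suc (prod_encode (prod_encode (a, m), i))) = rat_dec a *\<^sub>R e m + ratcomb e i"
  by (simp add: ratcomb_def)

lemma rat_dec_dense:
  assumes "\<delta> > 0" shows "\<exists>a. \<bar>rat_dec a - c\<bar> < \<delta>"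
proof -
  obtain d where d: "inverse (real (Suc d)) < \<delta>" using reals_Archimedean[OF assms] by blast
  define z where "z = \<lfloor>c * real (Suc d)\<rfloor>"
  have "\<bar>of_int z - c * real (Suc d)\<bar> < 1" unfolding z_def by linarith
  then have "\<bar>(of_int z - c * real (Suc d)) / real (Suc d)\<bar> < 1 / real (Suc d)"
    by (simp add: divide_strict_right_mono del: of_nat_Suc)
  then have "\<bar>of_int z / real (Suc d) - c\<bar> < \<delta>"
    using d by (simp add: diff_divide_distrib inverse_eq_divide del: of_nat_Suc)
  then show ?thesis by (metis rat_dec_encode)
qed

text \<open>A vector of the span is approximated summand by summand: its real coefficients are
  replaced by rational ones, and half of the error is granted to the new summand.\<close>

lemma ratcomb_dense:
  assumes "computable_banach e" "\<epsilon> > 0" shows "\<exists>i. dist (ratcomb e i) x < \<epsilon>"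
proof -
  have *: "\<forall>\<epsilon>>0. \<exists>i. dist (ratcomb e i) y < \<epsilon>" if "y \<in> span (range e)" for y
    using that
  proof (induction rule: span_induct_alt)
    case base
    have "dist (ratcomb e 0) 0 < \<epsilon>" if "\<epsilon> > 0" for \<epsilon> using that by simp
    then show ?case by blast
  next
    case (step c x y)
    obtain m where m: "x = e m" using step by auto
    show ?case
    proof (intro allI impI)
      fix \<epsilon> :: real assume e: "\<epsilon> > 0"
      obtain i where i: "dist (ratcomb e i) y < \<epsilon> / 2" using step e by (meson half_gt_zero)
      \<comment> \<open>The 1 added to \<open>norm x\<close> keeps the denominator positive if
        \<open>x\<close> is 0.\<close>
      obtain a where a: "\<bar>rat_dec a - c\<bar> < \<epsilon> / (2 * (norm x + 1))"
        using rat_dec_dense[of "\<epsilon> / (2 * (norm x + 1))" c] e by (auto simp: add_nonneg_pos)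
      have "norm ((rat_dec a - c) *\<^sub>R x) \<le> \<bar>rat_dec a - c\<bar> * (norm x + 1)"
        by (simp add: mult_left_mono)
      also have "\<dots> \<le> \<epsilon> / (2 * (norm x + 1)) * (norm x + 1)" using a by (intro mult_right_mono) auto
      also have "\<dots> = \<epsilon> / 2"
        by (metis add_nonneg_pos divide_divide_eq_left less_irrefl nonzero_eq_divide_eq norm_ge_zero zero_less_one)
      finally have "norm ((rat_dec a - c) *\<^sub>R x + (ratcomb e i - y)) < \<epsilon>"
        using norm_triangle_ineq[of "(rat_dec a - c) *\<^sub>R x" "ratcomb e i - y"] i by (simp add: dist_norm)
      then have "dist (ratcomb e (Suc (prod_encode (prod_encode (a, m), i)))) (c *\<^sub>R x + y) < \<epsilon>"
        by (simp add: ratcomb_Suc dist_norm m algebra_simps)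
      then show "\<exists>i. dist (ratcomb e i) (c *\<^sub>R x + y) < \<epsilon>" by blast
    qed
  qed
  have "x \<in> closure (span (range e))" using assms(1) by (simp add: computable_banach_def)
  then obtain y where y: "y \<in> span (range e)" "dist y x < \<epsilon> / 2"
    using assms(2) unfolding closure_approachable by (meson half_gt_zero)
  then obtain i where "dist (ratcomb e i) y < \<epsilon> / 2" using * assms(2) by (meson half_gt_zero)
  then show ?thesis using y dist_triangle_half_r[of y "ratcomb e i" \<epsilon> x] dist_commute by metis
qed

text \<open>Scaling by \<open>2 ^ k\<close> and rounding down replaces rational distances by natural
  numbers. Of the error 2, one unit comes from the rational approximation and one from
  rounding.\<close>

lemma computable_banach_nat_dist:
  fixes e :: "nat \<Rightarrow> 'a::banach"
  assumes "computable_banach e"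
  obtains D where "\<And>i j k. \<bar>2 ^ k * dist (ratcomb e i) (ratcomb e j) - real (D i j k)\<bar> \<le> 2"
    and "tot 3 (\<lambda>p v. D (v 0) (v 1) (v 2))"
proof -
  obtain c r where c: "\<And>i j k. eval (\<lambda>_. 0) c [i, j, k] (r i j k)"
    and r: "\<And>i j k. \<bar>dist (ratcomb e i) (ratcomb e j) - rat_dec (r i j k)\<bar> \<le> (1/2) ^ k"
    using assms unfolding computable_banach_def by metis
  define Z where "Z i j k = fst (prod_decode (r i j k))" for i j k
  define d where "d i j k = Suc (snd (prod_decode (r i j k)))" for i j k
  \<comment> \<open>Even codes stand for nonnegative integers and odd ones for negative integers. A
    negative approximation is replaced by 0, which only moves it closer to a distance.\<close>
  define z where "z i j k = (if Z i j k mod 2 = 0 then Z i j k div 2 else 0)" for i j k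
  define D where "D i j k = (z i j k * 2 ^ k) div d i j k" for i j k
  have "\<bar>2 ^ k * dist (ratcomb e i) (ratcomb e j) - real (D i j k)\<bar> \<le> 2" for i j k
  proof -
    define x where "x = dist (ratcomb e i) (ratcomb e j)"
    define \<rho> where "\<rho> = real (z i j k) / real (d i j k)"
    have dpos: "real (d i j k) > 0" by (simp add: d_def)
    have x: "x \<ge> 0" by (simp add: x_def)
    have zz: "int (z i j k) = max 0 (int_decode (Z i j k))"
      unfolding z_def int_decode_def sum_decode_def
      by (auto simp: even_iff_mod_2_eq_zero)
    have \<rho>: "\<rho> = max 0 (rat_dec (r i j k))"
    proof -
      have "rat_dec (r i j k) = of_int (int_decode (Z i j k)) / real (d i j k)"
        by (simp add: rat_dec_def Z_def d_def split_beta)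
      moreover have "real (z i j k) = max 0 (of_int (int_decode (Z i j k)))"
        using arg_cong[OF zz, of real_of_int] by (simp add: of_int_max)
      ultimately show ?thesis using dpos
        by (simp add: \<rho>_def max_def divide_le_0_iff zero_le_divide_iff)
    qed
    have "\<bar>x - \<rho>\<bar> \<le> (1/2) ^ k" using r[of i j k] x unfolding \<rho> x_def[symmetric] by linarith
    then have "2 ^ k * \<bar>x - \<rho>\<bar> \<le> 2 ^ k * (1/2) ^ k" by (intro mult_left_mono) auto
    then have 1: "\<bar>2 ^ k * x - 2 ^ k * \<rho>\<bar> \<le> 1"
      by (simp add: abs_mult power_divide flip: right_diff_distrib)
    have "2 ^ k * \<rho> = real (z i j k * 2 ^ k) / real (d i j k)" by (simp add: \<rho>_def)
    then have "real (D i j k) = of_int \<lfloor>2 ^ k * \<rho>\<rfloor>"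
      by (simp only: D_def floor_divide_of_nat_eq)
    then have "\<bar>2 ^ k * \<rho> - real (D i j k)\<bar> \<le> 1" by linarith
    then show ?thesis using 1 unfolding x_def by linarith
  qed
  moreover have "tot 3 (\<lambda>p v. D (v 0) (v 1) (v 2))"
  proof -
    have r3: "tot 3 (\<lambda>p v. r (v 0) (v 1) (v 2))"
      unfolding tot_def
      by (rule exI[of _ "oracle_free c"])
        (auto simp: length_Suc_conv numeral_eq_Suc intro!: eval_oracle_free c)
    show ?thesis unfolding D_def z_def Z_def d_def by (intro tot_intros r3) simp_all
  qed
  ultimately show ?thesis by (rule that)
qed

section \<open>Evaluating a named operator at rational combinations\<close>

definition first_nonzero :: "(nat \<Rightarrow> nat) \<Rightarrow> nat \<Rightarrow> nat" where
  "first_nonzero h L = rec_nat (h 0) (\<lambda>l r. if r = 0 then h (Suc l) else r) L"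

lemma first_nonzero_eq_0: "first_nonzero h L = 0 \<longleftrightarrow> (\<forall>l\<le>L. h l = 0)"
  by (induction L) (auto simp: first_nonzero_def le_Suc_eq)

lemma first_nonzero_SucD:
  "first_nonzero h L = Suc v \<Longrightarrow> \<exists>l\<le>L. h l = Suc v \<and> (\<forall>j<l. h j = 0)"
proof (induction L)
  case (Suc L)
  show ?case
  proof (cases "first_nonzero h L = 0")
    case True
    then show ?thesis using Suc.prems first_nonzero_eq_0[of h L]
      by (intro exI[of _ "Suc L"]) (auto simp: first_nonzero_def)
  next
    case False
    then have "first_nonzero h (Suc L) = first_nonzero h L" by (simp add: first_nonzero_def)
    then show ?thesis using Suc by (metis le_SucI)
  qed
qed (simp add: first_nonzero_def)

text \<open>The code of a prefix of the constant sequence \<open>i\<close>, which is a Cauchy name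
  of \<open>ratcomb e i\<close>.\<close>

definition code_rep :: "nat \<Rightarrow> nat \<Rightarrow> nat" where
  "code_rep i l = rec_nat 0 (\<lambda>_ r. Suc (prod_encode (i, r))) l"

lemma code_rep_eq: "code_rep i l = list_encode (map (\<lambda>_. i) [0..<l])"
proof -
  have "code_rep i l = list_encode (replicate l i)" by (induction l) (simp_all add: code_rep_def)
  then show ?thesis by (simp add: map_replicate_const)
qed

text \<open>The associate \<open>p\<close> is run on this constant name, reading prefixes up to
  length \<open>L\<close>. The result 0 means that there is no answer yet; \<open>Suc j\<close>
  means that the image is within \<open>(1/2) ^ k\<close> of the combination with code
  \<open>j\<close>. Bounding the search keeps everything total.\<close>

definition approx_value :: "baire \<Rightarrow> nat \<Rightarrow> nat \<Rightarrow> nat \<Rightarrow> nat" where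
  "approx_value p k i L = first_nonzero (\<lambda>l. p (prod_encode (k, code_rep i l))) L"

lemma assoc_apply_unique:
  assumes "assoc_apply p q r"
    and "p (prod_encode (n, list_encode (map q [0..<k]))) = Suc v"
    and "\<forall>j<k. p (prod_encode (n, list_encode (map q [0..<j]))) = 0"
  shows "r n = v"
proof -
  obtain k' where "p (prod_encode (n, list_encode (map q [0..<k']))) = Suc (r n)"
    "\<forall>j<k'. p (prod_encode (n, list_encode (map q [0..<j]))) = 0"
    using assms(1) unfolding assoc_apply_def by blast
  with assms(2,3) show ?thesis by (metis nat_neq_iff nat.distinct(1) nat.inject)
qed

lemma const_cauchy_name: "cauchy_names e (\<lambda>_. i) (ratcomb e i)"
  by (simp add: cauchy_names_def)

context
  fixes eX :: "nat \<Rightarrow> 'a::real_normed_vector" and eY :: "nat \<Rightarrow> 'b::real_normed_vector" and p T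
  assumes names: "fun_names (cauchy_names eX) (cauchy_names eY) p T"
begin

lemma const_assoc_apply:
  obtains r where "assoc_apply p (\<lambda>_. i) r" "cauchy_names eY r (T (ratcomb eX i))"
  using names const_cauchy_name unfolding fun_names_def by metis

lemma approx_value_sound:
  assumes "approx_value p k i L = Suc j"
  shows "dist (ratcomb eY j) (T (ratcomb eX i)) \<le> (1/2) ^ k"
proof -
  obtain r where r: "assoc_apply p (\<lambda>_. i) r" "cauchy_names eY r (T (ratcomb eX i))"
    by (rule const_assoc_apply)
  have "r k = j"
    using first_nonzero_SucD[OF assms[unfolded approx_value_def]] assoc_apply_unique[OF r(1)]
    unfolding code_rep_eq by blast
  then show ?thesis using r(2) by (auto simp: cauchy_names_def)
qed

lemma approx_value_complete: "\<exists>L0. \<forall>L\<ge>L0. approx_value p k i L \<noteq> 0"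
proof -
  obtain r where r: "assoc_apply p (\<lambda>_. i) r" by (rule const_assoc_apply)
  then obtain L0 where "p (prod_encode (k, code_rep i L0)) = Suc (r k)"
    unfolding code_rep_eq assoc_apply_def by blast
  then show ?thesis unfolding approx_value_def
    by (intro exI[of _ L0]) (auto simp: first_nonzero_eq_0 intro!: exI[of _ L0])
qed

end

text \<open>An associate may answer differently on different prefixes, since only its first answer
  counts. It therefore suffices that some prefix is answered and that every answer is
  correct.\<close>

lemma fun_names_cauchyI:
  assumes cont: "continuous_on UNIV T"
    and ex: "\<And>q x n. dX q x \<Longrightarrow> \<exists>k. s (prod_encode (n, list_encode (map q [0..<k]))) \<noteq> 0"
    and sound: "\<And>q x n k i. dX q x \<Longrightarrow> s (prod_encode (n, list_encode (map q [0..<k]))) = Suc i \<Longrightarrow>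
       dist (ratcomb e i) (T x) \<le> (1/2) ^ n"
  shows "fun_names dX (cauchy_names e) s T"
  unfolding fun_names_def
proof (intro conjI allI impI cont)
  fix q x assume q: "dX q x"
  let ?s = "\<lambda>n k. s (prod_encode (n, list_encode (map q [0..<k])))"
  have "\<exists>i k. ?s n k = Suc i \<and> (\<forall>j<k. ?s n j = 0)" for n
  proof -
    let ?k = "LEAST k. ?s n k \<noteq> 0"
    have "?s n ?k \<noteq> 0" using ex[OF q] by (rule LeastI_ex)
    moreover have "\<forall>j<?k. ?s n j = 0" using not_less_Least by blast
    ultimately show ?thesis by (metis not0_implies_Suc)
  qed
  then obtain r where r: "\<And>n. \<exists>k. ?s n k = Suc (r n) \<and> (\<forall>j<k. ?s n j = 0)" by metis
  then have "cauchy_names e r (T x)" unfolding cauchy_names_def using sound[OF q] by blast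
  moreover have "assoc_apply s q r" unfolding assoc_apply_def using r by blast
  ultimately show "\<exists>r. assoc_apply s q r \<and> cauchy_names e r (T x)" by blast
qed

section \<open>Inverting an operator with choice on the natural numbers\<close>

text \<open>Index 0 codes the zero vector, so \<open>DX\<close> and \<open>DY\<close> approximate
  scaled norms. The 3 absorbs the error 2 of \<open>DY\<close> and 1 of \<open>approx_value\<close>,
  and the 2 absorbs that of \<open>DX\<close>; passing the test thus proves that \<open>M\<close> is
  no valid bound.\<close>

definition unbounded_witness where
  "unbounded_witness DX DY p M i k L \<longleftrightarrow>
     0 < approx_value p k i L \<and> M * (DY (approx_value p k i L - 1) 0 k + 3) + 2 < DX i 0 k"

text \<open>The argument codes \<open>(M, i, k, L)\<close>. A name of a closed set of numbers lists
  \<open>Suc M\<close> to exclude \<open>M\<close>, and 0 excludes nothing.\<close>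

definition bound_refuter where
  "bound_refuter DX DY p c =
     (if unbounded_witness DX DY p (fst (prod_decode c)) (fst (prod_decode (snd (prod_decode c))))
         (fst (prod_decode (snd (prod_decode (snd (prod_decode c))))))
         (snd (prod_decode (snd (prod_decode (snd (prod_decode c))))))
      then Suc (fst (prod_decode c)) else 0)"

text \<open>Passing the test puts \<open>T (ratcomb e i)\<close> within \<open>(6 + 2 + 1 + 1) / 2 ^ k\<close> of the point named by \<open>w\<close>;
  with \<open>k = n + M + 4\<close> this is at most \<open>(1/2) ^ n / M\<close>.\<close>

definition preimage_test where
  "preimage_test DY p k w i \<longleftrightarrow> 0 < approx_value p k i w \<and> 0 < code_drop w k \<and>
     DY (approx_value p k i w - 1) (code_nth w k) k \<le> 6"

text \<open>The argument codes a precision \<open>n\<close> and a coded prefix \<open>w\<close>. The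
  number \<open>w\<close> also bounds the candidates and the search in \<open>approx_value\<close>:
  it is at least the length of the prefix, so longer prefixes allow longer searches.\<close>

definition inverse_name where
  "inverse_name DY p M c = first_nonzero (\<lambda>i. if preimage_test DY p (fst (prod_decode c) + M + 4)
      (snd (prod_decode c)) i then Suc i else 0) (snd (prod_decode c))"

context
  fixes eX :: "nat \<Rightarrow> 'a::banach" and eY :: "nat \<Rightarrow> 'b::banach" and DX DY p T
  assumes eX: "computable_banach eX"
    and DX: "\<And>i j k. \<bar>2 ^ k * dist (ratcomb eX i) (ratcomb eX j) - real (DX i j k)\<bar> \<le> 2"
    and DY: "\<And>i j k. \<bar>2 ^ k * dist (ratcomb eY i) (ratcomb eY j) - real (DY i j k)\<bar> \<le> 2"
    and names: "fun_names (cauchy_names eX) (cauchy_names eY) p T"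
    and lin: "bounded_linear T" and bij: "bij T"
begin

lemma approx_value_scaled:
  assumes "approx_value p k i L = Suc j"
  shows "\<bar>2 ^ k * dist (T (ratcomb eX i)) z - 2 ^ k * dist (ratcomb eY j) z\<bar> \<le> 1"
proof -
  have "\<bar>dist (T (ratcomb eX i)) z - dist (ratcomb eY j) z\<bar> \<le> (1/2) ^ k"
    using approx_value_sound[OF names assms] dist_triangle[of "ratcomb eY j" z "T (ratcomb eX i)"]
      dist_triangle2[of "T (ratcomb eX i)" z "ratcomb eY j"]
    by (smt (verit) dist_commute dist_triangle)
  then have "2 ^ k * \<bar>dist (T (ratcomb eX i)) z - dist (ratcomb eY j) z\<bar> \<le> 2 ^ k * (1/2) ^ k"
    by (intro mult_left_mono) auto
  then show ?thesis by (simp add: abs_mult power_divide flip: right_diff_distrib)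
qed

lemma bound_refuter_names:
  "Aminus_names (bound_refuter DX DY p) {M. \<forall>x. norm x \<le> real M * norm (T x)}"
proof -
  interpret T: bounded_linear T by (rule lin)
  have "(\<exists>x. norm x > real M * norm (T x)) \<longleftrightarrow> Suc M \<in> range (bound_refuter DX DY p)" for M
  proof
    assume "Suc M \<in> range (bound_refuter DX DY p)"
    then obtain i k L where w: "unbounded_witness DX DY p M i k L"
      unfolding bound_refuter_def by (auto split: if_splits)
    then obtain j where j: "approx_value p k i L = Suc j"
      and less: "M * (DY j 0 k + 3) + 2 < DX i 0 k"
      unfolding unbounded_witness_def by (auto simp: gr0_conv_Suc)
    have "2 ^ k * norm (T (ratcomb eX i)) \<le> real (DY j 0 k) + 3"
      using approx_value_scaled[OF j, of 0] DY[of k j 0] unfolding ratcomb_0 norm_conv_dist by linarith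
    then have "real M * (2 ^ k * norm (T (ratcomb eX i))) + 2 \<le> real (M * (DY j 0 k + 3) + 2)"
      by (simp add: mult_left_mono)
    also have "\<dots> < real (DX i 0 k)" using less by (simp only: of_nat_less_iff)
    also have "\<dots> \<le> 2 ^ k * norm (ratcomb eX i) + 2" using DX[of k i 0] unfolding ratcomb_0 norm_conv_dist by linarith
    finally have "2 ^ k * (real M * norm (T (ratcomb eX i))) < 2 ^ k * norm (ratcomb eX i)"
      by (simp add: algebra_simps)
    then show "\<exists>x. norm x > real M * norm (T x)" by auto
  next
    assume "\<exists>x. norm x > real M * norm (T x)"
    then obtain x0 where x0: "norm x0 - real M * norm (T x0) > 0" by auto
    \<comment> \<open>A strict violation persists near \<open>x0\<close>, hence at some rational
      combination.\<close>
    have "continuous (at x0) (\<lambda>x. norm x - real M * norm (T x))"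
      by (intro continuous_intros T.continuous)
    then have "\<forall>\<^sub>F x in at x0. norm x - real M * norm (T x) > 0"
      using x0 unfolding continuous_at by (rule order_tendstoD(1))
    then obtain d where d: "d > 0" "\<And>x. dist x x0 < d \<Longrightarrow> norm x - real M * norm (T x) > 0"
      unfolding eventually_at using x0 by (metis UNIV_I)
    obtain i where i: "dist (ratcomb eX i) x0 < d" using ratcomb_dense[OF eX d(1)] by blast
    define g where "g = norm (ratcomb eX i) - real M * norm (T (ratcomb eX i))"
    have g: "g > 0" using d(2)[OF i] by (simp add: g_def)
    \<comment> \<open>The test sees \<open>M * (2 ^ k * norm (T x) + 6) + 2\<close> at worst on the
      left and \<open>2 ^ k * norm x - 2\<close> on the right, so the scaled gap
      \<open>2 ^ k * g\<close> has to exceed \<open>6 * M + 4\<close>.\<close>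
    obtain k where k: "(real M * 6 + 4) / g < 2 ^ k" using real_arch_pow[of 2] by auto
    obtain L where L: "approx_value p k i L \<noteq> 0" using approx_value_complete[OF names] by blast
    then obtain j where j: "approx_value p k i L = Suc j" by (metis not0_implies_Suc)
    have "real (DY j 0 k) \<le> 2 ^ k * norm (T (ratcomb eX i)) + 3"
      using approx_value_scaled[OF j, of 0] DY[of k j 0] unfolding ratcomb_0 norm_conv_dist by linarith
    then have "real (M * (DY j 0 k + 3) + 2) \<le> real M * (2 ^ k * norm (T (ratcomb eX i)) + 6) + 2"
      by (simp add: mult_left_mono)
    also have "\<dots> < 2 ^ k * norm (ratcomb eX i) - 2"
      using k g by (simp add: g_def pos_divide_less_eq algebra_simps)
    also have "\<dots> \<le> real (DX i 0 k)" using DX[of k i 0] unfolding ratcomb_0 norm_conv_dist by linarith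
    finally have "unbounded_witness DX DY p M i k L"
      unfolding unbounded_witness_def j by (simp del: of_nat_add of_nat_mult)
    then have "bound_refuter DX DY p (prod_encode (M, prod_encode (i, prod_encode (k, L)))) = Suc M"
      by (simp add: bound_refuter_def)
    then show "Suc M \<in> range (bound_refuter DX DY p)" by (metis rangeI)
  qed
  then have "M \<in> - {M. \<forall>x. norm x \<le> real M * norm (T x)} \<longleftrightarrow> Suc M \<in> range (bound_refuter DX DY p)" for M
    by (simp add: not_le)
  then show ?thesis unfolding Aminus_names_def by blast
qed

lemma inverse_bound_exists: "{M. \<forall>x. norm x \<le> real M * norm (T x)} \<noteq> {}"
proof -
  obtain K where K: "\<And>x. norm x \<le> K * norm (T x)" by (rule bounded_inverse_theorem[OF lin bij]) blast
  obtain M where "K \<le> real M" using real_arch_simple by blast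
  then have "norm x \<le> real M * norm (T x)" for x
    using K[of x] mult_right_mono[of K "real M" "norm (T x)"] by (meson norm_ge_zero order_trans)
  then show ?thesis by blast
qed

text \<open>Applied to a difference, the bound \<open>M\<close> turns an error in the image into at
  most \<open>M\<close> times that error in the preimage. This gives both the Lipschitz continuity
  of \<open>inv T\<close> and the correctness of the answers.\<close>

lemma inverse_name_names:
  assumes M: "\<And>x. norm x \<le> real M * norm (T x)"
  shows "fun_names (cauchy_names eY) (cauchy_names eX) (inverse_name DY p M) (inv T)"
proof (rule fun_names_cauchyI)
  interpret T: bounded_linear T by (rule lin)
  have inv: "T (inv T y) = y" for y using bij by (simp add: bij_is_surj surj_f_inv_f)
  have inv_dist: "dist x (inv T y) \<le> real M * dist (T x) y" for x y
    using M[of "x - inv T y"] by (simp add: T.diff inv dist_norm)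
  show "continuous_on UNIV (inv T)"
  proof (rule lipschitz_on_continuous_on)
    show "(real M)-lipschitz_on UNIV (inv T)"
    proof (rule lipschitz_onI)
      show "dist (inv T x) (inv T y) \<le> real M * dist x y" for x y
        using inv_dist[of "inv T x" y] by (simp add: inv)
    qed simp
  qed
  fix q y n assume q: "cauchy_names eY q y"
  define k where "k = n + M + 4"
  have qk: "2 ^ k * dist (ratcomb eY (q k)) y \<le> 1"
  proof -
    have "2 ^ k * dist (ratcomb eY (q k)) y \<le> 2 ^ k * (1/2) ^ k"
      using q by (intro mult_left_mono) (auto simp: cauchy_names_def)
    then show ?thesis by (simp add: power_divide)
  qed
  have val: "inverse_name DY p M (prod_encode (n, w)) =
    first_nonzero (\<lambda>i. if preimage_test DY p k w i then Suc i else 0) w" for w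
    by (simp add: inverse_name_def k_def)
  show "\<exists>l. inverse_name DY p M (prod_encode (n, list_encode (map q [0..<l]))) \<noteq> 0"
  proof -
    have "continuous (at (inv T y)) T" by (simp add: T.isCont)
    then obtain d where d: "d > 0" "\<And>x. dist x (inv T y) < d \<Longrightarrow> dist (T x) y < (1/2) ^ k"
      unfolding continuous_at_eps_delta inv by (meson zero_less_power half_gt_zero zero_less_one)
    obtain i where "dist (ratcomb eX i) (inv T y) < d" using ratcomb_dense[OF eX d(1)] by blast
    then have "2 ^ k * dist (T (ratcomb eX i)) y \<le> 2 ^ k * (1/2) ^ k"
      using d(2) by (intro mult_left_mono) (auto intro: less_imp_le)
    then have i: "2 ^ k * dist (T (ratcomb eX i)) y \<le> 1" by (simp add: power_divide)
    obtain L0 where L0: "\<And>L. L \<ge> L0 \<Longrightarrow> approx_value p k i L \<noteq> 0"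
      using approx_value_complete[OF names] by blast
    \<comment> \<open>The prefix must contain \<open>q k\<close>; since its code is at least
      \<open>l\<close>, the candidate \<open>i\<close> lies in the search range and
      \<open>approx_value\<close> has answered.\<close>
    define l where "l = Suc (max k (max i L0))"
    define w where "w = list_encode (map q [0..<l])"
    have w: "l \<le> w" using length_le_list_encode[of "map q [0..<l]"] by (simp add: w_def)
    obtain j where j: "approx_value p k i w = Suc j"
      using L0[of w] w by (metis l_def le_SucI max.cobounded2 max.coboundedI2 not0_implies_Suc order_trans)
    have kl: "k < l" by (simp add: l_def)
    have nth: "code_nth w k = q k" using kl by (simp add: w_def code_nth_encode)
    have drop: "code_drop w k \<noteq> 0" using kl
      by (simp add: w_def code_drop_eq_0)
    have "2 ^ k * dist (ratcomb eY j) (ratcomb eY (q k)) \<le> 2 ^ k * (dist (ratcomb eY j) y + dist (ratcomb eY (q k)) y)"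
      by (intro mult_left_mono dist_triangle2) auto
    then have "2 ^ k * dist (ratcomb eY j) (ratcomb eY (q k)) \<le> 2 ^ k * dist (ratcomb eY j) y + 2 ^ k * dist (ratcomb eY (q k)) y"
      by (simp only: distrib_left)
    \<comment> \<open>At most 5 in fact: 1 each for continuity, \<open>approx_value\<close> and the
      name of \<open>y\<close>, and 2 for \<open>DY\<close>.\<close>
    then have "real (DY j (q k) k) \<le> 6"
      using DY[of k j "q k"] qk approx_value_scaled[OF j, of y] i by linarith
    then have "preimage_test DY p k w i" using drop by (simp add: preimage_test_def j nth)
    moreover have "i \<le> w" using w by (simp add: l_def)
    ultimately have "first_nonzero (\<lambda>i. if preimage_test DY p k w i then Suc i else 0) w \<noteq> 0"
      unfolding first_nonzero_eq_0 by (metis nat.distinct(1))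
    then show ?thesis unfolding val[symmetric] w_def by blast
  qed
  fix l i assume "inverse_name DY p M (prod_encode (n, list_encode (map q [0..<l]))) = Suc i"
  then have t: "preimage_test DY p k (list_encode (map q [0..<l])) i"
    unfolding val by (auto dest!: first_nonzero_SucD split: if_splits)
  define w where "w = list_encode (map q [0..<l])"
  obtain j where j: "approx_value p k i w = Suc j"
    using t by (auto simp: preimage_test_def w_def gr0_conv_Suc)
  have "k < l" using t code_drop_eq_0[of "map q [0..<l]" k] by (simp add: preimage_test_def not_le)
  then have nth: "code_nth w k = q k" by (simp add: w_def code_nth_encode)
  have D: "DY j (q k) k \<le> 6" using t j unfolding preimage_test_def w_def[symmetric] nth by simp
  have "2 ^ k * dist (T (ratcomb eX i)) y \<le> 2 ^ k * (dist (T (ratcomb eX i)) (ratcomb eY (q k)) + dist (ratcomb eY (q k)) y)"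
    by (intro mult_left_mono dist_triangle) auto
  then have "2 ^ k * dist (T (ratcomb eX i)) y \<le> 2 ^ k * dist (T (ratcomb eX i)) (ratcomb eY (q k)) + 2 ^ k * dist (ratcomb eY (q k)) y"
    by (simp only: distrib_left)
  \<comment> \<open>The sum of the errors is 10, rounded up to \<open>2 ^ 4\<close>. With
    \<open>M \<le> 2 ^ M\<close> the summands \<open>M\<close> and 4 of \<open>k\<close> cancel
    below, leaving precision \<open>n\<close>.\<close>
  then have *: "2 ^ k * dist (T (ratcomb eX i)) y \<le> 16"
    using qk approx_value_scaled[OF j, of "ratcomb eY (q k)"] DY[of k j "q k"] D by linarith
  have "2 ^ k * dist (ratcomb eX i) (inv T y) \<le> 2 ^ k * (real M * dist (T (ratcomb eX i)) y)"
    using inv_dist by (intro mult_left_mono) auto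
  also have "\<dots> = real M * (2 ^ k * dist (T (ratcomb eX i)) y)" by simp
  also have "\<dots> \<le> 2 ^ M * 16" using * by (intro mult_mono) (auto simp: less_imp_le)
  also have "\<dots> = 2 ^ k * (1/2) ^ n" by (simp add: k_def power_add power_divide)
  finally show "dist (ratcomb eX i) (inv T y) \<le> (1/2) ^ n" by simp
qed

end

lemma IMT_le_CN:
  fixes eX :: "nat \<Rightarrow> 'a::banach" and eY :: "nat \<Rightarrow> 'b::banach"
  assumes "computable_banach eX" and "computable_banach eY"
  shows "weihrauch_le
           (fun_names (cauchy_names eX) (cauchy_names eY))
           (fun_names (cauchy_names eY) (cauchy_names eX)) IMT
           Aminus_names nat_names CN"
proof -
  obtain DX where DX: "\<And>i j k. \<bar>2 ^ k * dist (ratcomb eX i) (ratcomb eX j) - real (DX i j k)\<bar> \<le> 2"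
    and totX: "tot 3 (\<lambda>p v. DX (v 0) (v 1) (v 2))" by (rule computable_banach_nat_dist[OF assms(1)]) blast
  obtain DY where DY: "\<And>i j k. \<bar>2 ^ k * dist (ratcomb eY i) (ratcomb eY j) - real (DY i j k)\<bar> \<le> 2"
    and totY: "tot 3 (\<lambda>p v. DY (v 0) (v 1) (v 2))" by (rule computable_banach_nat_dist[OF assms(2)]) blast
  define K where "K p = Some (bound_refuter DX DY p)" for p
  \<comment> \<open>Even positions of the paired input hold \<open>p\<close>, and position 1 holds
    the first value of the answer, which is the number \<open>M\<close>.\<close>
  define H where "H b = Some (inverse_name DY (\<lambda>x. b (2 * x)) (b 1))" for b
  have "computable_partial K"
    unfolding K_def bound_refuter_def unbounded_witness_def approx_value_def first_nonzero_def code_rep_def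
    by (rule computable_partial_total)
       (rule tot_intros tot_comp3[OF totX] tot_comp3[OF totY] | simp; fail)+
  moreover have "computable_partial H"
    unfolding H_def inverse_name_def preimage_test_def approx_value_def first_nonzero_def code_rep_def
    by (rule computable_partial_total)
       (rule tot_intros tot_comp3[OF totX] tot_comp3[OF totY] | simp; fail)+
  moreover have "realizer (fun_names (cauchy_names eX) (cauchy_names eY))
           (fun_names (cauchy_names eY) (cauchy_names eX)) IMT
      (\<lambda>p. case K p of None \<Rightarrow> None | Some k \<Rightarrow> (case G k of None \<Rightarrow> None | Some r \<Rightarrow> H (bpair p r)))"
    if G: "realizer Aminus_names nat_names CN G" for G
    unfolding realizer_def
  proof (intro allI impI, elim conjE)
    fix p and T :: "'a \<Rightarrow> 'b"
    assume p: "fun_names (cauchy_names eX) (cauchy_names eY) p T" and "IMT T \<noteq> {}"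
    then have T: "bounded_linear T" "bij T" and IMT: "IMT T = {inv T}" by (auto simp: IMT_def split: if_splits)
    note ctx = assms(1) DX DY p T
    obtain r M where r: "G (bound_refuter DX DY p) = Some r" "r 0 = M" "\<And>x. norm x \<le> real M * norm (T x)"
      using G[unfolded realizer_def, rule_format, OF conjI[OF bound_refuter_names[OF ctx]]]
        inverse_bound_exists[OF ctx] by (auto simp: CN_def nat_names_def)
    have "H (bpair p r) = Some (inverse_name DY p M)"
      by (simp add: H_def bpair_def r)
    then show "\<exists>q y. (case K p of None \<Rightarrow> None | Some k \<Rightarrow> (case G k of None \<Rightarrow> None | Some r \<Rightarrow> H (bpair p r))) = Some q
       \<and> fun_names (cauchy_names eY) (cauchy_names eX) q y \<and> y \<in> IMT T"
      using inverse_name_names[OF ctx r(3)] IMT by (simp add: K_def r)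
  qed
  ultimately show ?thesis unfolding weihrauch_le_def by blast
qed

section \<open>The computable Banach space of square-summable sequences\<close>

lemma summable_l2_seq: "summable (\<lambda>n. (l2_seq x n)\<^sup>2)"
  using l2_seq[of x] by simp

lemma l2_norm_sq: "(norm x)\<^sup>2 = (\<Sum>n. (l2_seq x n)\<^sup>2)"
  unfolding power2_norm_eq_inner inner_l2.rep_eq by (simp add: power2_eq_square)

lemma l2_partial_sum_le: "(\<Sum>k<K. (l2_seq x k)\<^sup>2) \<le> (norm x)\<^sup>2"
  unfolding l2_norm_sq by (intro sum_le_suminf summable_l2_seq) auto

lemma l2_coord_le: "\<bar>l2_seq x n\<bar> \<le> norm x"
proof -
  have "(l2_seq x n)\<^sup>2 \<le> (\<Sum>k<Suc n. (l2_seq x k)\<^sup>2)"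
    by (simp add: sum_nonneg)
  then have "(l2_seq x n)\<^sup>2 \<le> (norm x)\<^sup>2" using l2_partial_sum_le[where K="Suc n" and x=x] by linarith
  then show ?thesis by (simp flip: abs_le_square_iff)
qed

lemma l2_norm_leI:
  assumes "\<And>K. (\<Sum>k<K. (l2_seq x k)\<^sup>2) \<le> c\<^sup>2" "c \<ge> 0" shows "norm x \<le> c"
proof -
  have "(norm x)\<^sup>2 \<le> c\<^sup>2"
    unfolding l2_norm_sq by (rule suminf_le_const[OF summable_l2_seq assms(1)])
  then show ?thesis using assms(2) by (rule power2_le_imp_le)
qed

text \<open>The limit is taken coordinatewise. Cauchy estimates hold for finite partial sums
  uniformly in their length, so they survive this limit and yield convergence in norm.\<close>

instance l2 :: banach
proof
  fix X :: "nat \<Rightarrow> l2" assume X: "Cauchy X"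
  have "Cauchy (\<lambda>n. l2_seq (X n) k)" for k
  proof (rule metric_CauchyI)
    fix e :: real assume "e > 0"
    then obtain N where N: "\<And>m n. m \<ge> N \<Longrightarrow> n \<ge> N \<Longrightarrow> dist (X m) (X n) < e" using metric_CauchyD[OF X] by blast
    have "dist (l2_seq (X m) k) (l2_seq (X n) k) < e" if "m \<ge> N" "n \<ge> N" for m n
      using N[OF that] l2_coord_le[of "X m - X n" k]
      by (simp add: dist_norm minus_l2.rep_eq)
    then show "\<exists>N. \<forall>m\<ge>N. \<forall>n\<ge>N. dist (l2_seq (X m) k) (l2_seq (X n) k) < e" by blast
  qed
  then have "\<exists>l. (\<lambda>n. l2_seq (X n) k) \<longlonglongrightarrow> l" for k
    using Cauchy_convergent unfolding convergent_def by blast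
  then obtain f where f: "\<And>k. (\<lambda>n. l2_seq (X n) k) \<longlonglongrightarrow> f k" by metis
  have bound: "\<exists>N. \<forall>m\<ge>N. \<forall>K. (\<Sum>k<K. (l2_seq (X m) k - f k)\<^sup>2) \<le> e\<^sup>2" if "e > 0" for e
  proof -
    obtain N where N: "\<And>m n. m \<ge> N \<Longrightarrow> n \<ge> N \<Longrightarrow> dist (X m) (X n) < e"
      using metric_CauchyD[OF X \<open>e > 0\<close>] by blast
    have "(\<Sum>k<K. (l2_seq (X m) k - f k)\<^sup>2) \<le> e\<^sup>2" if m: "m \<ge> N" for m K
    proof (rule LIMSEQ_le_const2)
      show "(\<lambda>n. \<Sum>k<K. (l2_seq (X m) k - l2_seq (X n) k)\<^sup>2) \<longlonglongrightarrow> (\<Sum>k<K. (l2_seq (X m) k - f k)\<^sup>2)"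
        by (intro tendsto_intros f)
      have "(\<Sum>k<K. (l2_seq (X m) k - l2_seq (X n) k)\<^sup>2) \<le> e\<^sup>2" if n: "n \<ge> N" for n
      proof -
        have "(\<Sum>k<K. (l2_seq (X m) k - l2_seq (X n) k)\<^sup>2) \<le> (norm (X m - X n))\<^sup>2"
          using l2_partial_sum_le[of "X m - X n" K] by (simp add: minus_l2.rep_eq)
        also have "\<dots> \<le> e\<^sup>2" using N[OF m n] by (intro power_mono) (auto simp: dist_norm)
        finally show ?thesis .
      qed
      then show "\<exists>N. \<forall>n\<ge>N. (\<Sum>k<K. (l2_seq (X m) k - l2_seq (X n) k)\<^sup>2) \<le> e\<^sup>2" by blast
    qed
    then show ?thesis by blast
  qed
  have sd: "summable (\<lambda>k. (l2_seq (X m) k - f k)\<^sup>2)" if "\<forall>K. (\<Sum>k<K. (l2_seq (X m) k - f k)\<^sup>2) \<le> c" for m c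
    by (rule summableI_nonneg_bounded[of _ c]) (use that in auto)
  obtain N where "\<forall>K. (\<Sum>k<K. (l2_seq (X N) k - f k)\<^sup>2) \<le> 1\<^sup>2" using bound[OF zero_less_one] by blast
  then have "summable (\<lambda>k. (l2_seq (X N) k - f k)\<^sup>2)" by (rule sd)
  \<comment> \<open>The limit is the square-summable \<open>X N\<close> minus the square-summable
    difference.\<close>
  then have "summable (\<lambda>k. (l2_seq (X N) k + - (l2_seq (X N) k - f k))\<^sup>2)"
    by (intro l2_summable_add[OF summable_l2_seq]) (simp only: power2_minus)
  then have sf: "summable (\<lambda>k. (f k)\<^sup>2)" by simp
  define x where "x = Abs_l2 f"
  have x: "l2_seq x = f" unfolding x_def using sf by (simp add: Abs_l2_inverse)
  have "X \<longlonglongrightarrow> x"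
  proof (rule metric_LIMSEQ_I)
    fix e :: real assume e: "e > 0"
    then have "e / 2 > 0" by simp
    from bound[OF this] obtain N where N: "\<And>m K. m \<ge> N \<Longrightarrow> (\<Sum>k<K. (l2_seq (X m) k - f k)\<^sup>2) \<le> (e/2)\<^sup>2"
      by blast
    have "dist (X m) x \<le> e/2" if "m \<ge> N" for m
      unfolding dist_norm by (rule l2_norm_leI) (use N[OF that] e in \<open>simp_all add: minus_l2.rep_eq x\<close>)
    then have "dist (X m) x < e" if "m \<ge> N" for m
      by (rule le_less_trans) (use e that in simp_all)
    then show "\<exists>N. \<forall>n\<ge>N. dist (X n) x < e" by blast
  qed
  then show "convergent X" by (auto simp: convergent_def)
qed

lemma l2_seq_sum: "l2_seq (\<Sum>i\<in>A. f i) n = (\<Sum>i\<in>A. l2_seq (f i) n)"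
  by (induction A rule: infinite_finite_induct) (simp_all add: zero_l2.rep_eq plus_l2.rep_eq)

lemma l2_seq_truncation:
  "l2_seq (\<Sum>k<K. l2_seq x k *\<^sub>R l2_unit k) n = (if n < K then l2_seq x n else 0)"
proof -
  have "l2_seq (\<Sum>k<K. l2_seq x k *\<^sub>R l2_unit k) n = (\<Sum>k<K. if n = k then l2_seq x k else 0)"
    unfolding l2_seq_sum by (intro sum.cong) (auto simp: scaleR_l2.rep_eq l2_unit.rep_eq)
  then show ?thesis by simp
qed

lemma l2_truncation_dist_sq:
  "(dist (\<Sum>k<K. l2_seq x k *\<^sub>R l2_unit k) x)\<^sup>2 = (\<Sum>n. (l2_seq x (n + K))\<^sup>2)"
proof -
  let ?g = "\<lambda>n. (l2_seq ((\<Sum>k<K. l2_seq x k *\<^sub>R l2_unit k) - x) n)\<^sup>2"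
  have g: "?g n = (if n < K then 0 else (l2_seq x n)\<^sup>2)" for n
    by (simp add: minus_l2.rep_eq l2_seq_truncation)
  have "(dist (\<Sum>k<K. l2_seq x k *\<^sub>R l2_unit k) x)\<^sup>2 = (\<Sum>n. ?g (n + K)) + (\<Sum>n<K. ?g n)"
    unfolding dist_norm l2_norm_sq by (rule suminf_split_initial_segment) (rule summable_l2_seq)
  then show ?thesis unfolding g by simp
qed

lemma l2_unit_dense: "closure (span (range l2_unit)) = UNIV"
proof -
  have "x \<in> closure (span (range l2_unit))" for x
  proof -
    let ?t = "\<lambda>K. \<Sum>k<K. l2_seq x k *\<^sub>R l2_unit k"
    have "(\<lambda>K. (dist (?t K) x)\<^sup>2) \<longlonglongrightarrow> 0"
      unfolding l2_truncation_dist_sq by (rule suminf_exist_split2) (rule summable_l2_seq)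
    then have "(\<lambda>K. sqrt ((dist (?t K) x)\<^sup>2)) \<longlonglongrightarrow> sqrt 0" by (rule tendsto_real_sqrt)
    then have "?t \<longlonglongrightarrow> x" by (subst tendsto_dist_iff) simp
    moreover have "?t K \<in> span (range l2_unit)" for K
      by (intro span_sum span_scale span_base rangeI)
    ultimately have "\<forall>K. ?t K \<in> span (range l2_unit)" "?t \<longlonglongrightarrow> x" by simp_all
    then show ?thesis unfolding closure_sequential by (intro exI[of _ ?t] conjI)
  qed
  then show ?thesis by blast
qed

text \<open>Distances in \<open>\<ell>\<^sup>2\<close> between rational combinations are square roots of rationals, which are computed
  exactly: multiplying by the product of all denominators makes every coefficient an integer, kept as
  a difference of two natural numbers.\<close>

definition term_index :: "nat \<Rightarrow> nat" where "term_index x = snd (prod_decode x)"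
definition term_den :: "nat \<Rightarrow> nat" where "term_den x = Suc (snd (prod_decode (fst (prod_decode x))))"
definition term_num :: "nat \<Rightarrow> nat" where "term_num x = fst (prod_decode (fst (prod_decode x)))"
definition term_pos :: "nat \<Rightarrow> nat" where
  "term_pos x = (if term_num x mod 2 = 0 then term_num x div 2 else 0)"
definition term_neg :: "nat \<Rightarrow> nat" where
  "term_neg x = (if term_num x mod 2 = 0 then 0 else Suc (term_num x div 2))"
definition term_coeff :: "nat \<Rightarrow> real" where "term_coeff x = rat_dec (fst (prod_decode x))"

lemmas term_defs = term_index_def term_den_def term_pos_def term_neg_def term_num_def

lemma term_coeff_eq: "term_coeff x = (real (term_pos x) - real (term_neg x)) / real (term_den x)"
proof -
  have "of_int (int_decode z) = real (if z mod 2 = 0 then z div 2 else 0) - real (if z mod 2 = 0 then 0 else Suc (z div 2))" for z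
    by (simp add: int_decode_def sum_decode_def even_iff_mod_2_eq_zero)
  then show ?thesis
    by (simp only: term_coeff_def rat_dec_def split_beta term_defs)
qed

lemma ratcomb_eq: "ratcomb e c = (\<Sum>x\<leftarrow>list_decode c. term_coeff x *\<^sub>R e (term_index x))"
  by (simp add: ratcomb_def term_coeff_def term_index_def split_beta comp_def)

lemma l2_seq_sum_list: "l2_seq (sum_list (map f xs)) n = (\<Sum>x\<leftarrow>xs. l2_seq (f x) n)"
  by (induction xs) (simp_all add: zero_l2.rep_eq plus_l2.rep_eq)

lemma l2_seq_ratcomb:
  "l2_seq (ratcomb l2_unit c) n = (\<Sum>x\<leftarrow>list_decode c. if term_index x = n then term_coeff x else 0)"
  unfolding ratcomb_eq l2_seq_sum_list
  by (intro arg_cong[of _ _ sum_list] map_cong) (auto simp: scaleR_l2.rep_eq l2_unit.rep_eq)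

lemma term_index_less: "x \<in> set (list_decode c) \<Longrightarrow> term_index x < c"
  unfolding term_index_def
  by (metis le_less_trans le_prod_encode_2 list_decode_inverse mem_less_list_encode prod.collapse prod_decode_inverse)

text \<open>Every index in a combination is smaller than the code. This makes distances finite sums,
  and later turns a code into a bound on the stages of change.\<close>

lemma l2_seq_ratcomb_eq_0:
  assumes "c \<le> n" shows "l2_seq (ratcomb l2_unit c) n = 0"
proof -
  have *: "map (\<lambda>x. if term_index x = n then term_coeff x else 0) (list_decode c) = map (\<lambda>_. 0) (list_decode c)"
    using term_index_less[of _ c] assms by (intro map_cong) force+
  show ?thesis unfolding l2_seq_ratcomb * by simp
qed

definition code_den :: "nat \<Rightarrow> nat" where
  "code_den c = fold (\<lambda>x r. term_den x * r) (list_decode c) 1"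

text \<open>With \<open>term_pos\<close> or \<open>term_neg\<close> for \<open>h\<close> this
  collects the positive or negative contributions to \<open>q\<close> times coordinate
  \<open>n\<close>. The multiplier \<open>q\<close> is a parameter so that two combinations can
  share one.\<close>

definition scaled_coeff :: "(nat \<Rightarrow> nat) \<Rightarrow> nat \<Rightarrow> nat \<Rightarrow> nat \<Rightarrow> nat" where
  "scaled_coeff h c q n =
     fold (\<lambda>x r. (if term_index x = n then h x * (q div term_den x) else 0) + r) (list_decode c) 0"

lemma fold_plus_eq: "fold (\<lambda>x r. f x + r) xs (b::nat) = b + (\<Sum>x\<leftarrow>xs. f x)"
  by (induction xs arbitrary: b) auto

lemma fold_mult_eq: "fold (\<lambda>x r. f x * r) xs (b::nat) = b * (\<Prod>x\<leftarrow>xs. f x)"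
  by (induction xs arbitrary: b) auto

lemma code_den_pos: "code_den c > 0"
proof -
  have "prod_list (map term_den xs) > 0" for xs by (induction xs) (simp_all add: term_den_def)
  then show ?thesis by (simp add: code_den_def fold_mult_eq)
qed

lemma term_den_dvd: "x \<in> set (list_decode c) \<Longrightarrow> term_den x dvd code_den c"
  unfolding code_den_def fold_mult_eq by (simp add: prod_list_dvd)

lemma scaled_coeff_eq:
  assumes "code_den c dvd q"
  shows "real q * l2_seq (ratcomb l2_unit c) n =
     real (scaled_coeff term_pos c q n) - real (scaled_coeff term_neg c q n)"
proof -
  have "real q * (\<Sum>x\<leftarrow>xs. if term_index x = n then term_coeff x else 0) =
     real (\<Sum>x\<leftarrow>xs. if term_index x = n then term_pos x * (q div term_den x) else 0)
     - real (\<Sum>x\<leftarrow>xs. if term_index x = n then term_neg x * (q div term_den x) else 0)"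
    if "\<forall>x\<in>set xs. term_den x dvd q" for xs
    using that
  proof (induction xs)
    case (Cons x xs)
    have "real (q div term_den x) = real q / real (term_den x)"
      using Cons.prems by (simp add: real_of_nat_div)
    then show ?case using Cons by (simp add: term_coeff_eq algebra_simps diff_divide_distrib)
  qed simp
  moreover have "\<forall>x\<in>set (list_decode c). term_den x dvd q"
    using term_den_dvd assms dvd_trans by blast
  ultimately show ?thesis unfolding l2_seq_ratcomb scaled_coeff_def fold_plus_eq by simp
qed

text \<open>Negative parts are moved across, so \<open>a\<close> and \<open>b\<close> are sums of
  natural numbers, and the two truncated differences add up to the absolute difference.\<close>

definition coeff_gap :: "nat \<Rightarrow> nat \<Rightarrow> nat \<Rightarrow> nat" where
  "coeff_gap i j n =
    (let q = code_den i * code_den j;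
         a = scaled_coeff term_pos i q n + scaled_coeff term_neg j q n;
         b = scaled_coeff term_neg i q n + scaled_coeff term_pos j q n
     in (a - b) + (b - a))"

lemma coeff_gap_eq:
  "real (coeff_gap i j n) = real (code_den i * code_den j) * \<bar>l2_seq (ratcomb l2_unit i - ratcomb l2_unit j) n\<bar>"
proof -
  let ?q = "code_den i * code_den j"
  have "real ?q * l2_seq (ratcomb l2_unit i - ratcomb l2_unit j) n =
     real ?q * l2_seq (ratcomb l2_unit i) n - real ?q * l2_seq (ratcomb l2_unit j) n"
    by (simp add: minus_l2.rep_eq right_diff_distrib)
  also have "\<dots> = real (scaled_coeff term_pos i ?q n + scaled_coeff term_neg j ?q n)
     - real (scaled_coeff term_neg i ?q n + scaled_coeff term_pos j ?q n)"
    using scaled_coeff_eq[of i ?q n] scaled_coeff_eq[of j ?q n] by simp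
  finally have "\<bar>real ?q * l2_seq (ratcomb l2_unit i - ratcomb l2_unit j) n\<bar> = real (coeff_gap i j n)"
    unfolding coeff_gap_def Let_def by linarith
  then show ?thesis by (simp add: abs_mult)
qed

lemma two_power_sq: "((2::real) ^ n)\<^sup>2 = 4 ^ n"
  by (simp add: power2_eq_square flip: power_mult_distrib)

text \<open>The range \<open>n < i + j\<close> covers both supports. Doubling encodes a nonnegative
  numerator, and denominators are stored minus one.\<close>

definition l2_dist_code :: "nat \<Rightarrow> nat \<Rightarrow> nat \<Rightarrow> nat" where
  "l2_dist_code i j k =
     prod_encode (2 * nat \<lfloor>sqrt (real ((\<Sum>n<i + j. coeff_gap i j n * coeff_gap i j n) * 4 ^ k))\<rfloor>,
       code_den i * code_den j * 2 ^ k - 1)"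

text \<open>Rounding the root changes the numerator by at most 1, hence the value by at most
  \<open>1 / (q * 2 ^ k)\<close>, where \<open>q \<ge> 1\<close>.\<close>

lemma l2_dist_code_correct:
  "\<bar>dist (ratcomb l2_unit i) (ratcomb l2_unit j) - rat_dec (l2_dist_code i j k)\<bar> \<le> (1/2) ^ k"
proof -
  define q where "q = real (code_den i * code_den j)"
  have q: "q \<ge> 1" unfolding q_def using code_den_pos[of i] code_den_pos[of j]
    by (metis Suc_leI nat_0_less_mult_iff of_nat_1 of_nat_le_iff One_nat_def)
  let ?x = "ratcomb l2_unit i - ratcomb l2_unit j"
  define S where "S = (\<Sum>n<i + j. coeff_gap i j n * coeff_gap i j n)"
  define d where "d = dist (ratcomb l2_unit i) (ratcomb l2_unit j)"
  have d: "d \<ge> 0" by (simp add: d_def)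
  have "d\<^sup>2 = (\<Sum>n. (l2_seq ?x n)\<^sup>2)" by (simp add: d_def dist_norm l2_norm_sq)
  also have "\<dots> = (\<Sum>n<i + j. (l2_seq ?x n)\<^sup>2)"
    by (intro suminf_finite) (auto simp: minus_l2.rep_eq l2_seq_ratcomb_eq_0)
  finally have "q\<^sup>2 * d\<^sup>2 = (\<Sum>n<i + j. (q * \<bar>l2_seq ?x n\<bar>)\<^sup>2)"
    by (simp add: sum_distrib_left power_mult_distrib)
  also have "\<dots> = real S"
    unfolding S_def q_def coeff_gap_eq[symmetric] by (simp add: power2_eq_square)
  finally have "real (S * 4 ^ k) = (q * d * 2 ^ k)\<^sup>2"
    by (simp add: power_mult_distrib two_power_sq mult.commute)
  then have sq: "sqrt (real (S * 4 ^ k)) = q * d * 2 ^ k" using q d by simp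
  define m where "m = nat \<lfloor>q * d * 2 ^ k\<rfloor>"
  have qd: "q * d * 2 ^ k \<ge> 0" using q d by simp
  have m: "\<bar>q * d * 2 ^ k - real m\<bar> \<le> 1" unfolding m_def using qd by linarith
  have "int_decode (2 * m) = int m" by (simp add: int_decode_def sum_decode_def)
  moreover have "real (Suc (code_den i * code_den j * 2 ^ k - 1)) = q * 2 ^ k"
    using code_den_pos[of i] code_den_pos[of j] by (simp add: q_def)
  ultimately have "rat_dec (l2_dist_code i j k) = real m / (q * 2 ^ k)"
    unfolding l2_dist_code_def S_def[symmetric] sq m_def[symmetric] by (simp add: rat_dec_def del: of_nat_Suc)
  then have "d - rat_dec (l2_dist_code i j k) = (q * d * 2 ^ k - real m) / (q * 2 ^ k)"
    using q by (simp add: field_simps)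
  then have "\<bar>d - rat_dec (l2_dist_code i j k)\<bar> = \<bar>q * d * 2 ^ k - real m\<bar> / (q * 2 ^ k)"
    using q by (simp add: abs_divide)
  also have "\<dots> \<le> 1 / 2 ^ k" using m q by (intro frac_le) auto
  finally show ?thesis by (simp add: d_def power_divide)
qed

lemma computable_banach_l2: "computable_banach l2_unit"
proof -
  have ti: "tot n (\<lambda>p e. term_index (f p e))" and td: "tot n (\<lambda>p e. term_den (f p e))"
    and tn: "tot n (\<lambda>p e. term_num (f p e))" if "tot n f" for n f
    unfolding term_index_def term_den_def term_num_def by (intro tot_intros that)+
  have tp: "tot n (\<lambda>p e. term_pos (f p e))" and tg: "tot n (\<lambda>p e. term_neg (f p e))" if "tot n f" for n f
    unfolding term_pos_def term_neg_def by (intro tot_intros tn that)+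
  have tc: "tot n (\<lambda>p e. code_den (f p e))" if "tot n f" for n f
    by (rule tot_comp1[OF _ that]) (unfold code_den_def, (rule tot_intros td | simp; fail)+)
  have ts: "tot n (\<lambda>p e. scaled_coeff h (f p e) (g p e) (k p e))"
    if "\<And>n f. tot n f \<Longrightarrow> tot n (\<lambda>p e. h (f p e))" "tot n f" "tot n g" "tot n k" for n h f g k
    by (rule tot_comp3[OF _ that(2-4)]) (unfold scaled_coeff_def, (rule tot_intros ti td that(1) | simp; fail)+)
  have tgap: "tot n (\<lambda>p e. coeff_gap (f p e) (g p e) (k p e))" if "tot n f" "tot n g" "tot n k" for n f g k
    by (rule tot_comp3[OF _ that]) (unfold coeff_gap_def Let_def, (rule tot_intros tc ts tp tg | assumption | simp; fail)+)
  have "tot 3 (\<lambda>p e. l2_dist_code (e 0) (e 1) (e 2))"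
    unfolding l2_dist_code_def by (rule tot_intros tc tgap | simp; fail)+
  then obtain c where "\<And>p xs. length xs = 3 \<Longrightarrow> eval p c xs (l2_dist_code (xs ! 0) (xs ! 1) (xs ! 2))"
    unfolding tot_def by blast
  from this[of "[_, _, _]"] have "eval (\<lambda>_. 0) c [i, j, k] (l2_dist_code i j k)" for i j k by simp
  then show ?thesis
    unfolding computable_banach_def using l2_unit_dense l2_dist_code_correct by blast
qed


section \<open>Choice on the natural numbers from inverting a diagonal operator\<close>

definition candidate :: "baire \<Rightarrow> nat \<Rightarrow> nat" where
  "candidate p s = rec_nat 0 (\<lambda>s r. if \<exists>i<Suc s. p i = Suc r then Suc r else r) s"

definition change_at :: "baire \<Rightarrow> nat \<Rightarrow> bool" where
  "change_at p s \<longleftrightarrow> (\<exists>i<Suc s. p i = Suc (candidate p s))"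

lemma candidate_0: "candidate p 0 = 0"
  and candidate_Suc: "candidate p (Suc s) = (if change_at p s then Suc (candidate p s) else candidate p s)"
  by (simp_all add: candidate_def change_at_def)

text \<open>An element of \<open>A\<close> is never refuted, and the candidate moves in steps of
  one, so it cannot pass \<open>a\<close>.\<close>

lemma candidate_le:
  assumes "Aminus_names p A" "a \<in> A" shows "candidate p s \<le> a"
proof (induction s)
  case (Suc s)
  have "Suc a \<notin> range p" using assms unfolding Aminus_names_def by blast
  then have "candidate p s \<noteq> a" if "change_at p s"
    using that unfolding change_at_def by (metis rangeI)
  then show ?case using Suc by (force simp: candidate_Suc)
qed (simp add: candidate_0)

lemma candidate_eq_card: "candidate p s = card {t. t < s \<and> change_at p t}"
proof (induction s)
  case (Suc s)
  have "{t. t < Suc s \<and> change_at p t} =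
     (if change_at p s then insert s {t. t < s \<and> change_at p t} else {t. t < s \<and> change_at p t})"
    by (auto simp: less_Suc_eq)
  then show ?case using Suc by (simp add: candidate_Suc)
qed (simp add: candidate_0)

text \<open>The candidate counts the changes so far, and any element of \<open>A\<close> bounds
  it.\<close>

lemma finite_changes:
  assumes "Aminus_names p A" "A \<noteq> {}" shows "finite {s. change_at p s}"
proof (rule ccontr)
  assume inf: "infinite {s. change_at p s}"
  obtain a where a: "a \<in> A" using assms by blast
  obtain F where F: "finite F" "card F = Suc a" "F \<subseteq> {s. change_at p s}"
    using infinite_arbitrarily_large[OF inf] by blast
  obtain s where "\<forall>t\<in>F. t < s" using F(1) by (metis finite_nat_set_iff_bounded)
  then have "card F \<le> card {t. t < s \<and> change_at p t}" using F(3) by (intro card_mono) auto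
  then show False using candidate_le[OF assms(1) a, of s] F(2)
    by (simp add: candidate_eq_card)
qed

lemma candidate_mem:
  assumes "Aminus_names p A" and stable: "\<And>s. s \<ge> N \<Longrightarrow> \<not> change_at p s"
  shows "candidate p N \<in> A"
proof -
  have const: "candidate p (N + d) = candidate p N" for d
    by (induction d) (simp_all add: candidate_Suc stable)
  \<comment> \<open>Stage \<open>N + i\<close> inspects position \<open>i\<close> while the
    candidate is still the one of stage \<open>N\<close>.\<close>
  have "p i \<noteq> Suc (candidate p N)" for i
    using stable[of "N + i"] const[of i] unfolding change_at_def
    by (metis le_add1 le_add2 less_Suc_eq_le)
  then have "Suc (candidate p N) \<notin> range p" by (metis rangeE)
  then show ?thesis using assms(1) unfolding Aminus_names_def by blast
qed

section \<open>The diagonal operator and its name\<close>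

lift_definition damp :: "nat set \<Rightarrow> l2 \<Rightarrow> l2" is "\<lambda>S f n. if n \<in> S then f n / 2 ^ n else f n"
proof -
  fix S and f :: "nat \<Rightarrow> real" assume f: "summable (\<lambda>n. (f n)\<^sup>2)"
  have "(f n / 2 ^ n)\<^sup>2 \<le> (f n)\<^sup>2" for n
    by (simp add: power_divide divide_le_eq mult_le_cancel_left1 one_le_power flip: power_mult)
  then show "summable (\<lambda>n. (if n \<in> S then f n / 2 ^ n else f n)\<^sup>2)"
    by (intro summable_comparison_test'[OF f]) simp
qed

lemma norm_damp_le: "norm (damp S x) \<le> norm x"
proof (rule l2_norm_leI)
  fix K
  have "(f / 2 ^ n)\<^sup>2 \<le> f\<^sup>2" for n and f :: real
    by (simp add: power_divide divide_le_eq mult_le_cancel_left1 one_le_power flip: power_mult)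
  then have "(\<Sum>k<K. (l2_seq (damp S x) k)\<^sup>2) \<le> (\<Sum>k<K. (l2_seq x k)\<^sup>2)"
    by (intro sum_mono) (simp add: damp.rep_eq)
  then show "(\<Sum>k<K. (l2_seq (damp S x) k)\<^sup>2) \<le> (norm x)\<^sup>2"
    using l2_partial_sum_le[of x K] by linarith
qed simp

lemma l2_eqI: "(\<And>n. l2_seq x n = l2_seq y n) \<Longrightarrow> x = y"
  by (metis ext l2_seq_inject)

lemma bounded_linear_damp: "bounded_linear (damp S)"
proof (rule bounded_linear_intro[where K=1])
  show "damp S (x + y) = damp S x + damp S y" for x y
    by (rule l2_eqI) (simp add: damp.rep_eq plus_l2.rep_eq add_divide_distrib)
  show "damp S (r *\<^sub>R x) = r *\<^sub>R damp S x" for r x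
    by (rule l2_eqI) (simp add: damp.rep_eq scaleR_l2.rep_eq)
qed (simp add: norm_damp_le)

text \<open>Undoing the factors alters only finitely many coordinates, so the preimage stays
  square-summable.\<close>

lemma bij_damp:
  assumes "finite S" shows "bij (damp S)"
proof (rule bijI)
  show "inj (damp S)"
  proof (rule injI, rule l2_eqI)
    fix x y n assume "damp S x = damp S y"
    then have "l2_seq (damp S x) n = l2_seq (damp S y) n" by simp
    then show "l2_seq x n = l2_seq y n" by (simp add: damp.rep_eq split: if_splits)
  qed
  have "\<exists>x. y = damp S x" for y
  proof -
    let ?f = "\<lambda>n. if n \<in> S then 2 ^ n * l2_seq y n else l2_seq y n"
    have "summable (\<lambda>n. (?f n)\<^sup>2 - (l2_seq y n)\<^sup>2)"
      using assms by (intro summable_finite) auto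
    from summable_add[OF this summable_l2_seq[of y]] have "l2_seq (Abs_l2 ?f) = ?f"
      by (simp add: Abs_l2_inverse)
    then have "y = damp S (Abs_l2 ?f)" by (intro l2_eqI) (simp add: damp.rep_eq)
    then show ?thesis by blast
  qed
  then show "surj (damp S)" by (metis surjI)
qed

text \<open>Whether a stage is a change is decidable from \<open>p\<close>, so the scaling is exact:
  the denominator is multiplied by the power of 2 and stored minus one.\<close>

definition damp_term :: "baire \<Rightarrow> nat \<Rightarrow> nat" where
  "damp_term p x = (if change_at p (term_index x)
     then prod_encode (prod_encode (term_num x, term_den x * 2 ^ term_index x - 1), term_index x) else x)"

definition damp_code :: "baire \<Rightarrow> nat \<Rightarrow> nat" where
  "damp_code p c = fold (\<lambda>x r. Suc (prod_encode (damp_term p x, r))) (list_decode c) 0"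

text \<open>The operator is a contraction, so entry \<open>n\<close> of the input name is already
  precise enough for entry \<open>n\<close> of the output. The answer is given once the prefix
  contains this entry.\<close>

definition damp_name :: "baire \<Rightarrow> nat \<Rightarrow> nat" where
  "damp_name p c = (if code_drop (snd (prod_decode c)) (fst (prod_decode c)) = 0 then 0
      else Suc (damp_code p (code_nth (snd (prod_decode c)) (fst (prod_decode c)))))"

lemma damp_term_index: "term_index (damp_term p x) = term_index x"
  by (simp add: damp_term_def) (simp add: term_index_def)

lemma damp_term_coeff:
  "term_coeff (damp_term p x) = (if change_at p (term_index x) then term_coeff x / 2 ^ term_index x else term_coeff x)"
proof (cases "change_at p (term_index x)")
  case True
  have "real (Suc (term_den x * 2 ^ term_index x - 1)) = real (term_den x) * 2 ^ term_index x"
    by (simp add: term_den_def algebra_simps)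
  moreover have "term_coeff x = of_int (int_decode (term_num x)) / real (term_den x)"
    by (simp add: term_coeff_def rat_dec_def split_beta term_num_def term_den_def)
  ultimately show ?thesis using True
    by (simp add: damp_term_def term_coeff_def[of "prod_encode _"] rat_dec_def del: of_nat_Suc)
qed (simp add: damp_term_def)

text \<open>The code of the image lists its terms in reverse order, which does not affect the sum.\<close>

lemma ratcomb_damp_code: "ratcomb l2_unit (damp_code p c) = damp {s. change_at p s} (ratcomb l2_unit c)"
proof -
  interpret D: bounded_linear "damp {s. change_at p s}" by (rule bounded_linear_damp)
  have unit: "damp {s. change_at p s} (l2_unit m) = (if change_at p m then (1 / 2 ^ m) *\<^sub>R l2_unit m else l2_unit m)" for m
    by (rule l2_eqI) (simp add: damp.rep_eq l2_unit.rep_eq scaleR_l2.rep_eq)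
  have "ratcomb l2_unit (fold (\<lambda>x r. Suc (prod_encode (damp_term p x, r))) xs b) =
     ratcomb l2_unit b + damp {s. change_at p s} (\<Sum>x\<leftarrow>xs. term_coeff x *\<^sub>R l2_unit (term_index x))" for xs b
    by (induction xs arbitrary: b)
      (simp_all add: ratcomb_eq D.zero D.add D.scaleR unit damp_term_index damp_term_coeff)
  then show ?thesis by (simp add: damp_code_def ratcomb_eq[of l2_unit c])
qed

lemma damp_name_names:
  "fun_names (cauchy_names l2_unit) (cauchy_names l2_unit) (damp_name p) (damp {s. change_at p s})"
proof (rule fun_names_cauchyI)
  interpret D: bounded_linear "damp {s. change_at p s}" by (rule bounded_linear_damp)
  show "continuous_on UNIV (damp {s. change_at p s})"
    by (intro linear_continuous_on bounded_linear_damp)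
  fix q x n assume q: "cauchy_names l2_unit q x"
  show "\<exists>k. damp_name p (prod_encode (n, list_encode (map q [0..<k]))) \<noteq> 0"
    by (rule exI[of _ "Suc n"]) (simp add: damp_name_def code_drop_eq_0 del: upt_Suc list_encode.simps)
  fix k i assume "damp_name p (prod_encode (n, list_encode (map q [0..<k]))) = Suc i"
  then have "n < k" and i: "i = damp_code p (q n)"
    by (auto simp: damp_name_def code_drop_eq_0 code_nth_encode split: if_splits)
  have "dist (ratcomb l2_unit i) (damp {s. change_at p s} x) \<le> dist (ratcomb l2_unit (q n)) x"
    unfolding i ratcomb_damp_code dist_norm D.diff[symmetric] by (rule norm_damp_le)
  also have "\<dots> \<le> (1/2) ^ n" using q by (simp add: cauchy_names_def)
  finally show "dist (ratcomb l2_unit i) (damp {s. change_at p s} x) \<le> (1/2) ^ n" .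
qed

section \<open>The geometric test vector and its name\<close>

lift_definition geometric_l2 :: l2 is "\<lambda>n. 1 / 2 ^ n"
proof -
  have "(\<lambda>n. (1 / 2 ^ n)\<^sup>2) = (\<lambda>n. (1/4::real) ^ n)"
    by (simp add: fun_eq_iff power_divide two_power_sq)
  then show "summable (\<lambda>n. (1 / 2 ^ n :: real)\<^sup>2)" by (simp add: summable_geometric)
qed

text \<open>The code 2 stands for the integer 1, and \<open>2 ^ i - 1\<close> for the denominator
  \<open>2 ^ i\<close>.\<close>

definition geometric_code :: "nat \<Rightarrow> nat" where
  "geometric_code K = rec_nat 0 (\<lambda>i r. Suc (prod_encode (prod_encode (prod_encode (2, 2 ^ i - 1), i), r))) K"

lemma ratcomb_geometric_code:
  "ratcomb l2_unit (geometric_code K) = (\<Sum>k<K. l2_seq geometric_l2 k *\<^sub>R l2_unit k)"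
proof (induction K)
  case (Suc K)
  have "rat_dec (prod_encode (2, 2 ^ K - 1)) = 1 / 2 ^ K"
    by (simp add: rat_dec_def int_decode_def sum_decode_def)
  then show ?case using Suc
    by (simp add: geometric_code_def ratcomb_Suc geometric_l2.rep_eq add.commute)
qed (simp add: geometric_code_def)

text \<open>With \<open>Suc n\<close> terms the squared error is
  \<open>(1/4) ^ Suc n * (4/3)\<close>, below the required \<open>(1/4) ^ n\<close>; with
  \<open>n\<close> terms the factor 4/3 would exceed it.\<close>

lemma geometric_name: "cauchy_names l2_unit (\<lambda>n. geometric_code (Suc n)) geometric_l2"
  unfolding cauchy_names_def
proof
  fix n
  have "(dist (ratcomb l2_unit (geometric_code (Suc n))) geometric_l2)\<^sup>2 = (\<Sum>k. (1 / 2 ^ (k + Suc n))\<^sup>2)"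
    unfolding ratcomb_geometric_code l2_truncation_dist_sq by (simp add: geometric_l2.rep_eq)
  also have "(\<lambda>k. (1 / 2 ^ (k + Suc n))\<^sup>2) = (\<lambda>k. (1/4) ^ Suc n * (1/4::real) ^ k)"
    by (simp add: fun_eq_iff power_divide power_add power_mult_distrib two_power_sq)
  also have "(\<Sum>k. (1/4) ^ Suc n * (1/4::real) ^ k) = (1/4) ^ Suc n * (4/3)"
    by (subst suminf_mult) (simp_all add: suminf_geometric summable_geometric)
  also have "\<dots> \<le> (1/4) ^ n" by simp
  also have "\<dots> = ((1/2) ^ n)\<^sup>2" by (simp add: power_divide two_power_sq)
  finally show "dist (ratcomb l2_unit (geometric_code (Suc n))) geometric_l2 \<le> (1/2) ^ n"
    by (rule power2_le_imp_le) simp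
qed

text \<open>List codes grow at the front, so the prefix is built from its last entry
  backwards.\<close>

definition prefix_code :: "baire \<Rightarrow> nat \<Rightarrow> nat" where
  "prefix_code q k = rec_nat 0 (\<lambda>t r. Suc (prod_encode (q (k - Suc t), r))) k"

lemma prefix_code_eq: "prefix_code q k = list_encode (map q [0..<k])"
proof -
  have "rec_nat 0 (\<lambda>t r. Suc (prod_encode (q (k - Suc t), r))) t = list_encode (map q [k - t..<k])" if "t \<le> k" for t
    using that
  proof (induction t)
    case (Suc t)
    then have "[k - Suc t..<k] = (k - Suc t) # [k - t..<k]"
      by (simp add: upt_conv_Cons Suc_diff_Suc)
    then show ?case using Suc by simp
  qed simp
  from this[of k] show ?thesis by (simp add: prefix_code_def)
qed

lemma CN_le_IMT_l2:
  "weihrauch_le Aminus_names nat_names CN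
     (fun_names (cauchy_names l2_unit) (cauchy_names l2_unit))
     (fun_names (cauchy_names l2_unit) (cauchy_names l2_unit)) (IMT :: (l2 \<Rightarrow> l2) \<Rightarrow> _)"
proof -
  define q where "q n = geometric_code (Suc n)" for n
  \<comment> \<open>Odd positions of \<open>b\<close> hold the associate of the inverse. It is asked
    for output entry 1, that is precision 1/2, on the prefix of length \<open>k\<close> of the name
    of \<open>geometric_l2\<close>.\<close>
  define t where "t b k = b (Suc (2 * prod_encode (1, prefix_code q k)))" for b :: baire and k
  define K where "K p = Some (damp_name p)" for p
  \<comment> \<open>The first answer \<open>Suc j\<close> supplies the code \<open>j\<close> of an
    approximation, and \<open>j\<close> itself serves as the stage at which the candidate is
    final.\<close>
  define H where "H b = (if \<exists>k. t b k \<noteq> 0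
     then Some (\<lambda>_::nat. candidate (\<lambda>x. b (2 * x)) (t b (LEAST k. t b k \<noteq> 0) - 1)) else None)" for b
  have "computable_partial K"
    unfolding K_def damp_name_def damp_code_def damp_term_def change_at_def candidate_def term_defs
    by (rule computable_partial_total) (rule tot_intros | simp; fail)+
  moreover have "computable_partial H"
    unfolding H_def
    by (rule computable_partial_search;
        unfold t_def prefix_code_def q_def geometric_code_def candidate_def)
       (rule tot_intros | simp; fail)+
  moreover have "realizer Aminus_names nat_names CN
      (\<lambda>p. case K p of None \<Rightarrow> None | Some k \<Rightarrow> (case G k of None \<Rightarrow> None | Some r \<Rightarrow> H (bpair p r)))"
    if G: "realizer (fun_names (cauchy_names l2_unit) (cauchy_names l2_unit))
     (fun_names (cauchy_names l2_unit) (cauchy_names l2_unit)) (IMT :: (l2 \<Rightarrow> l2) \<Rightarrow> _) G" for G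
    unfolding realizer_def
  proof (intro allI impI, elim conjE)
    fix p A assume p: "Aminus_names p A" and "CN A \<noteq> {}"
    then have A: "A \<noteq> {}" by (simp add: CN_def)
    let ?S = "{s. change_at p s}"
    have bij: "bij (damp ?S)" by (intro bij_damp finite_changes[OF p A])
    then have IMT: "IMT (damp ?S) = {inv (damp ?S)}"
      by (simp add: IMT_def bounded_linear_damp)
    obtain r where r: "G (damp_name p) = Some r"
      "fun_names (cauchy_names l2_unit) (cauchy_names l2_unit) r (inv (damp ?S))"
      using G[unfolded realizer_def, rule_format, OF conjI[OF damp_name_names]] IMT by force
    define z where "z = inv (damp ?S) geometric_l2"
    have z: "damp ?S z = geometric_l2" unfolding z_def using bij by (simp add: bij_is_surj surj_f_inv_f)
    obtain v where v: "assoc_apply r q v" "cauchy_names l2_unit v z"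
      using r(2) geometric_name unfolding fun_names_def q_def[abs_def] z_def by blast
    have t: "t (bpair p r) k = r (prod_encode (1, list_encode (map q [0..<k])))" for k
      by (simp add: t_def bpair_def prefix_code_eq)
    have ex: "\<exists>k. t (bpair p r) k \<noteq> 0"
      using v(1) unfolding assoc_apply_def t by (metis nat.distinct(1))
    let ?k = "LEAST k. t (bpair p r) k \<noteq> 0"
    have k: "t (bpair p r) ?k \<noteq> 0" using ex by (rule LeastI_ex)
    then obtain j where j: "t (bpair p r) ?k = Suc j" by (metis not0_implies_Suc)
    moreover have "\<forall>j<?k. t (bpair p r) j = 0" using not_less_Least by blast
    ultimately have "v 1 = j" unfolding t by (intro assoc_apply_unique[OF v(1)])
    then have dist: "dist (ratcomb l2_unit j) z \<le> 1 / 2" using v(2) unfolding cauchy_names_def by (metis power_one_right)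
    have stable: "\<not> change_at p s" if "s \<ge> j" for s
    proof
      assume s: "change_at p s"
      \<comment> \<open>At a change \<open>z\<close> has coordinate 1, while the combination with
        code \<open>j\<close> vanishes from \<open>j\<close> on; a distance of at least 1
        contradicts 1/2.\<close>
      have "l2_seq (damp ?S z) s = 1 / 2 ^ s" by (simp add: z geometric_l2.rep_eq)
      then have "l2_seq z s = 1" using s by (simp add: damp.rep_eq)
      then have "\<bar>l2_seq (ratcomb l2_unit j - z) s\<bar> = 1"
        using that by (simp add: minus_l2.rep_eq l2_seq_ratcomb_eq_0)
      then show False using l2_coord_le[of "ratcomb l2_unit j - z" s] dist by (simp add: dist_norm)
    qed
    have "candidate p j \<in> A" by (rule candidate_mem[OF p stable])
    moreover have "H (bpair p r) = Some (\<lambda>_. candidate p j)"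
      using ex j by (simp add: H_def bpair_def)
    ultimately show "\<exists>q y. (case K p of None \<Rightarrow> None | Some k \<Rightarrow> (case G k of None \<Rightarrow> None | Some r \<Rightarrow> H (bpair p r))) = Some q
       \<and> nat_names q y \<and> y \<in> CN A"
      by (simp add: K_def r nat_names_def CN_def)
  qed
  ultimately show ?thesis unfolding weihrauch_le_def by blast
qed

theorem theorem5p3:
  fixes eX :: "nat \<Rightarrow> 'a::banach" and eY :: "nat \<Rightarrow> 'b::banach"
  assumes "computable_banach eX" and "computable_banach eY"
  shows "weihrauch_le
           (fun_names (cauchy_names eX) (cauchy_names eY))
           (fun_names (cauchy_names eY) (cauchy_names eX)) IMT
           Aminus_names nat_names CN
       \<and> weihrauch_le
           Aminus_names nat_names CN
           (fun_names (cauchy_names l2_unit) (cauchy_names l2_unit))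
           (fun_names (cauchy_names l2_unit) (cauchy_names l2_unit)) (IMT :: (l2 \<Rightarrow> l2) \<Rightarrow> _)
       \<and> weihrauch_le
           (fun_names (cauchy_names l2_unit) (cauchy_names l2_unit))
           (fun_names (cauchy_names l2_unit) (cauchy_names l2_unit)) (IMT :: (l2 \<Rightarrow> l2) \<Rightarrow> _)
           Aminus_names nat_names CN"
  using IMT_le_CN[OF assms] CN_le_IMT_l2 IMT_le_CN[OF computable_banach_l2 computable_banach_l2] by blast

end
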